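(* Let $\alpha>0$, $\beta>-1$ be real numbers, let $m,m'\in\{0,1,2,\ldots\}$, and put $\mu:=m+m'$, $\nu:=m-m'$. Then for every $r\in\mathbb{R}$, $$\sum_{l=1}^{\infty}\frac{J_{l+m'}(r)J_{l+m}(r)}{(l+\beta)^\alpha}=\frac{2\,i^{-\mu}}{\pi^2}\int_{0}^{\pi/2}\int_{0}^{\pi}e^{i2r\cos\varphi\cos\theta}\,F_{\alpha,\beta,\mu}(\varphi)\cos(\nu\theta)\,d\varphi\,d\theta$$ and $$\sum_{l=1}^{\infty}\frac{J_{l+m'}(r)J_{l+m}(r)}{(l+\beta)^\alpha}=\frac{(-1)^{m'}}{\pi}\int_{0}^{\pi}J_{\nu}(2r\cos\varphi)\,F_{\alpha,\beta,\mu}(\varphi)\,d\varphi .$$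
   Context: $J_n$ denotes the Bessel function of the first kind of order $n$. $\Phi$ denotes the Lerch transcendent, $\Phi(z,\alpha,\beta)=\sum_{n=0}^\infty \frac{z^n}{(\beta+n)^\alpha}$ for $|z|<1$ (or $|z|\le 1$ if $\alpha>1$), extended to other values of $z$ by analytic continuation in $z$ (in particular to points $z\ne1$ of the unit circle). For $\alpha>0$, $\beta>-1$ and $\mu\in\mathbb{Z}_{\ge0}$, $$F_{\alpha,\beta,\mu}(\varphi):=-\tfrac12 e^{-i\varphi(\mu+2)}\left(e^{2i\varphi(\mu+2)}\,\Phi\!\left(-e^{2i\varphi},\alpha,\beta+1\right)+\Phi\!\left(-e^{-2i\varphi},\alpha,\beta+1\right)\right),$$ defined for $\varphi\in[0,\pi]$, $\varphi\neq\pi/2$ (a possible singularity at the single point $\varphi=\pi/2$ is irrelevant for the integrals). *)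

theory Defs
  imports "HOL-Complex_Analysis.Complex_Analysis"
begin

text \<open>
  Bessel function of the first kind of integer order, by its power series
  \<open>J\<^sub>n(x) = \<Sum>k. (-1)^k / (k! \<Gamma>(k+n+1)) (x/2)^(2k+n)\<close>. For negative \<open>n\<close> the terms with
  \<open>k + n < 0\<close> vanish because \<^const>\<open>rGamma\<close> is zero at the nonpositive integers, so that
  no negative power of \<open>x\<close> contributes, also at \<open>x = 0\<close>.
\<close>
definition bessel_J :: "int \<Rightarrow> 'a :: Gamma \<Rightarrow> 'a" where
  "bessel_J n x =
     (\<Sum>k. (-1) ^ k / fact k * rGamma (of_int (int k + n + 1)) * (x / 2) powi (2 * int k + n))"

definition lerch_series :: "complex \<Rightarrow> real \<Rightarrow> real \<Rightarrow> complex" where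
  "lerch_series z \<alpha> \<beta> =
     (\<Sum>n. z ^ n / complex_of_real (\<beta> + real n) powr complex_of_real \<alpha>)"

text \<open>
  Outside the region where the series is used, the value is that of the analytic
  continuation of the series from the unit disc to the plane cut along \<open>[1,\<infinity>)\<close>; the
  continuation is unique because this region is connected. On the cut itself the value is
  unspecified, except at \<open>z = 1\<close> when \<open>\<alpha> > 1\<close>.
\<close>
definition lerch_Phi :: "complex \<Rightarrow> real \<Rightarrow> real \<Rightarrow> complex" where
  "lerch_Phi z \<alpha> \<beta> =
     (if norm z < 1 \<or> norm z \<le> 1 \<and> \<alpha> > 1 then lerch_series z \<alpha> \<beta>
      else (THE w. \<exists>g. g holomorphic_on (- complex_of_real ` {1..}) \<and>
                       (\<forall>u. norm u < 1 \<longrightarrow> g u = lerch_series u \<alpha> \<beta>) \<and> w = g z))"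

definition F :: "real \<Rightarrow> real \<Rightarrow> nat \<Rightarrow> real \<Rightarrow> complex" where
  "F \<alpha> \<beta> \<mu> \<phi> =
     - (1 / 2) * exp (- \<i> * of_real \<phi> * of_nat (\<mu> + 2)) *
       (exp (2 * \<i> * of_real \<phi> * of_nat (\<mu> + 2)) *
          lerch_Phi (- exp (2 * \<i> * of_real \<phi>)) \<alpha> (\<beta> + 1)
        + lerch_Phi (- exp (- 2 * \<i> * of_real \<phi>)) \<alpha> (\<beta> + 1))"

end

theory Submission imports Defs begin

text \<open>
  For \<open>z\<close> off \<open>[1,\<infinity>)\<close> the Lerch transcendent is
  \<open>\<Phi>(z,\<alpha>,b) = 1/\<Gamma>(\<alpha>) \<integral>\<^sub>0\<^sup>\<infinity> t\<^bsup>\<alpha>-1\<^esup> e\<^bsup>-bt\<^esup> / (1 - z e\<^bsup>-t\<^esup>) dt\<close>.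
  Since \<open>\<bar>1 - z e\<^bsup>-t\<^esup>\<bar>\<close> is at least \<open>1 - e\<^bsup>-t\<^esup>\<close> and, for \<open>z = -s e\<^bsup>2i\<phi>\<^esup>\<close> with \<open>0 \<le> s < 1\<close>, also at
  least \<open>\<bar>cos \<phi>\<bar>\<close>, interpolating the two bounds dominates \<open>\<Phi>\<close>, uniformly in \<open>s\<close>, by
  \<open>K \<bar>cos \<phi>\<bar>\<^bsup>\<delta>-1\<^esup>\<close> for some small \<open>\<delta> > 0\<close>. This is integrable in \<open>\<phi>\<close>, so letting \<open>s \<rightarrow> 1\<close> shows that
  \<open>F\<close> may be integrated termwise, as the cosine series
  \<open>\<Sum>\<^bsub>l\<ge>1\<^esub> (-1)\<^sup>l cos((2l+\<mu>)\<phi>) / (l+\<beta>)\<^sup>\<alpha>\<close>, against any continuous function whose coefficients with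
  respect to these cosines are absolutely summable. For the two integrands of the theorem the
  coefficients are products of Bessel functions, by Neumann's integrals for \<open>J\<^sub>p J\<^sub>q\<close>; these follow by
  comparing power series.
\<close>

subsection \<open>The Lerch transcendent as an integral\<close>

text \<open>Euler's integral for \<open>Gamma a\<close> after the substitution t -> b t. The factor
  \<open>b powr (1 - a)\<close> cancels the power of b that (b t)^(a-1) produces.\<close>

lemma has_bochner_integral_powr_exp:
  fixes a b :: real
  assumes "a > 0" "b > 0"
  shows "has_bochner_integral lborel
           (\<lambda>t. indicator {0<..} t * (t powr (a - 1) * exp (- (b * t)))) (Gamma a / b powr a)"
proof -
  define f where "f t = indicator {0<..} t * (t powr (a - 1) * exp (- t))" for t :: real
  have "(\<integral>\<^sup>+t. ennreal (f t) \<partial>lborel) =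
        (\<integral>\<^sup>+t. ennreal (indicator {0..} t * t powr (a - 1) / exp t) \<partial>lborel)"
    by (intro nn_integral_cong) (auto simp: f_def indicator_def exp_minus field_simps)
  then have "has_bochner_integral lborel f (Gamma a)"
    using \<open>a > 0\<close> Gamma_real_pos[of a]
    by (intro has_bochner_integral_nn_integral) (auto simp: f_def[abs_def] Gamma_conv_nn_integral_real)
  then have "has_bochner_integral lborel (\<lambda>t. b powr (1 - a) * f (0 + b * t)) (b powr (1 - a) * (Gamma a /\<^sub>R \<bar>b\<bar>))"
    using \<open>b > 0\<close>
    by (intro has_bochner_integral_mult_right lborel_has_bochner_integral_real_affine_iff[THEN iffD1]) auto
  moreover have "b powr (1 - a) * f (0 + b * t) = indicator {0<..} t * (t powr (a - 1) * exp (- (b * t)))" for t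
    using \<open>b > 0\<close>
    by (auto simp: f_def indicator_def zero_less_mult_iff powr_mult powr_diff)
  moreover have "b powr (1 - a) * (Gamma a /\<^sub>R \<bar>b\<bar>) = Gamma a / b powr a"
    using \<open>b > 0\<close> by (simp add: powr_diff field_simps)
  ultimately show ?thesis by simp
qed

text \<open>The indicator turns integrals over the positive half line into integrals over
  \<open>lborel\<close>; for t \<le> 0 every integrand built from the weight is zero.\<close>

definition lerch_weight :: "real \<Rightarrow> real \<Rightarrow> real \<Rightarrow> real" where
  "lerch_weight a b t = indicator {0<..} t * (t powr (a - 1) * exp (- (b * t)))"

definition lerch_kernel :: "real \<Rightarrow> real \<Rightarrow> complex \<Rightarrow> real \<Rightarrow> complex" where
  "lerch_kernel a b z t = of_real (lerch_weight a b t) / (1 - z * of_real (exp (- t)))"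

definition lerch_integral :: "real \<Rightarrow> real \<Rightarrow> complex \<Rightarrow> complex" where
  "lerch_integral a b z = (\<integral>t. lerch_kernel a b z t \<partial>lborel) / Gamma a"

lemma lerch_weight_nonneg: "lerch_weight a b t \<ge> 0"
  by (simp add: lerch_weight_def)

lemma measurable_lerch_weight [measurable]: "lerch_weight a b \<in> borel_measurable borel"
  unfolding lerch_weight_def by measurable

lemma measurable_lerch_kernel [measurable]: "lerch_kernel a b z \<in> borel_measurable borel"
  unfolding lerch_kernel_def by measurable

lemma lerch_weight_shift: "lerch_weight a (b + real n) t = lerch_weight a b t * exp (- t) ^ n"
  by (simp add: lerch_weight_def exp_of_nat_mult [symmetric] exp_add [symmetric] algebra_simps)

lemma
  assumes "a > 0" "b > 0"
  shows integrable_lerch_weight: "integrable lborel (lerch_weight a b)"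
    and integral_lerch_weight: "(\<integral>t. lerch_weight a b t \<partial>lborel) = Gamma a / b powr a"
  using has_bochner_integral_powr_exp[OF assms]
  unfolding lerch_weight_def[abs_def] has_bochner_integral_iff by auto

text \<open>Expand 1 / (1 - z e^(-t)) as a geometric series and integrate termwise. The factor
  e^(-nt) shifts b to b + n in Euler's integral, and the integrals of the norms are dominated by a
  geometric series in \<open>norm z\<close>.\<close>

lemma lerch_series_eq_integral:
  assumes "a > 0" "b > 0" "norm z < 1"
  shows "lerch_series z a b = lerch_integral a b z"
proof -
  define f where "f n t = of_real (lerch_weight a (b + real n) t) * z ^ n" for n t
  have f_alt: "f n t = of_real (lerch_weight a b t) * (z * complex_of_real (exp (- t))) ^ n" for n t
    by (simp add: f_def lerch_weight_shift power_mult_distrib)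
  have int_f: "integrable lborel (f n)" for n
    unfolding f_def using assms by (intro integrable_mult_left integrable_of_real integrable_lerch_weight) auto
  have integral_f: "(\<integral>t. f n t \<partial>lborel) = Gamma a * (z ^ n / complex_of_real (b + real n) powr complex_of_real a)" for n
    unfolding f_def using assms
    by (simp add: integral_lerch_weight powr_of_real del: of_real_add)
  have norm_f: "norm (f n t) = lerch_weight a (b + real n) t * norm z ^ n" for n t
    by (simp add: f_def norm_mult norm_power lerch_weight_nonneg)
  have integral_norm_f: "(\<integral>t. norm (f n t) \<partial>lborel) = Gamma a / (b + real n) powr a * norm z ^ n" for n
    unfolding norm_f using assms by (simp add: integral_lerch_weight)
  have lt1: "norm (z * complex_of_real (exp (- t))) < 1" if "t > 0" for t :: real
  proof -
    have "norm z * (exp (- t)) \<le> norm z * 1"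
      using that by (intro mult_left_mono) auto
    then show ?thesis using assms by (simp add: norm_mult)
  qed
  have summable_f: "summable (\<lambda>n. norm (f n t))" for t
  proof (cases "t > 0")
    case True
    then show ?thesis unfolding f_alt norm_mult norm_power using lt1[of t]
      by (intro summable_mult summable_geometric) (auto simp: norm_mult)
  qed (simp add: f_def lerch_weight_def)
  have sum2: "summable (\<lambda>n. \<integral>t. norm (f n t) \<partial>lborel)"
  proof (rule summable_comparison_test')
    show "summable (\<lambda>n. Gamma a / b powr a * norm z ^ n)"
      using assms by (intro summable_mult summable_geometric) auto
    show "norm (\<integral>t. norm (f n t) \<partial>lborel) \<le> Gamma a / b powr a * norm z ^ n" for n
    proof -
      have "0 \<le> Gamma a" using assms Gamma_real_pos[of a] by simp
      then have "Gamma a / (b + real n) powr a * norm z ^ n \<le> Gamma a / b powr a * norm z ^ n"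
        using assms by (intro mult_right_mono frac_le order_refl powr_mono2) auto
      with \<open>0 \<le> Gamma a\<close> show ?thesis by (simp add: integral_norm_f)
    qed
  qed
  have "(\<Sum>n. f n t) = lerch_kernel a b z t" for t
  proof (cases "t > 0")
    case True
    then have "(\<lambda>n. f n t) sums (of_real (lerch_weight a b t) * (1 / (1 - z * complex_of_real (exp (- t)))))"
      unfolding f_alt using lt1[of t] by (intro sums_mult geometric_sums) auto
    then show ?thesis by (simp add: lerch_kernel_def sums_iff)
  qed (simp add: f_def lerch_kernel_def lerch_weight_def)
  then have "(\<Sum>n. \<integral>t. f n t \<partial>lborel) = (\<integral>t. lerch_kernel a b z t \<partial>lborel)"
    using integral_suminf[OF int_f _ sum2] summable_f by auto
  moreover have "(\<Sum>n. \<integral>t. f n t \<partial>lborel) = Gamma a * lerch_series z a b"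
    unfolding integral_f lerch_series_def
  proof (rule suminf_mult, rule summable_norm_cancel, rule summable_comparison_test')
    show "summable (\<lambda>n. 1 / b powr a * norm z ^ n)"
      using assms by (intro summable_mult summable_geometric) auto
    show "norm (norm (z ^ n / complex_of_real (b + real n) powr complex_of_real a)) \<le> 1 / b powr a * norm z ^ n" for n
    proof -
      have "norm z ^ n / (b + real n) powr a \<le> norm z ^ n / b powr a"
        using assms by (intro frac_le order_refl powr_mono2) auto
      with assms show ?thesis
        by (simp add: powr_of_real norm_divide norm_power del: of_real_add)
    qed
  qed
  moreover have "complex_of_real (Gamma a) \<noteq> 0"
    using Gamma_real_pos[OF \<open>a > 0\<close>] by (metis less_irrefl of_real_eq_0_iff)
  ultimately show ?thesis
    by (simp add: lerch_integral_def field_simps)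
qed

text \<open>The segment from 0 to z is compact and misses 1, since z lies off the cut, so it has a
  positive distance from 1. Half of that distance survives a small motion of z. The parameter s
  stands for e^(-t).\<close>

lemma one_minus_scaled_norm_lower_bound:
  fixes z :: complex
  assumes "z \<in> - complex_of_real ` {1..}"
  obtains d e where "d > 0" "e > 0"
    "\<And>w s. dist z w < e \<Longrightarrow> s \<in> {0..1} \<Longrightarrow> d \<le> norm (1 - w * complex_of_real s)"
proof -
  have "compact ((\<lambda>s. z * complex_of_real s) ` {0..1})"
    by (intro compact_continuous_image continuous_intros) auto
  moreover have "1 \<notin> (\<lambda>s. z * complex_of_real s) ` {0..1}"
  proof
    assume "1 \<in> (\<lambda>s. z * complex_of_real s) ` {0..1}"
    then obtain s where s: "s \<in> {0..1}" "1 = z * complex_of_real s" by auto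
    then have "s \<noteq> 0" by auto
    with s have "z = complex_of_real (1 / s)" "1 / s \<ge> 1" by (auto simp: field_simps)
    with assms show False by (metis ComplD atLeast_iff imageI)
  qed
  ultimately obtain d where d: "d > 0" "\<And>s. s \<in> {0..1} \<Longrightarrow> d \<le> dist 1 (z * complex_of_real s)"
    using separate_point_closed[of "(\<lambda>s. z * complex_of_real s) ` {0..1}" 1] compact_imp_closed by blast
  show ?thesis
  proof (rule that)
    fix w :: complex and s :: real
    assume w: "dist z w < d / 2" and s: "s \<in> {0..1}"
    have "norm ((z - w) * complex_of_real s) \<le> d / 2 * 1"
      unfolding norm_mult using w s d by (intro mult_mono) (auto simp: dist_norm)
    moreover have "norm (1 - z * complex_of_real s) \<le> norm (1 - w * complex_of_real s) + norm ((z - w) * complex_of_real s)"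
      using norm_triangle_ineq4[of "1 - w * complex_of_real s" "(z - w) * complex_of_real s"]
      by (simp add: algebra_simps)
    ultimately show "d / 2 \<le> norm (1 - w * complex_of_real s)"
      using d(2)[OF s] by (simp add: dist_norm)
  qed (use d in auto)
qed

text \<open>Differentiation under the integral sign: near z the difference quotients of the kernel
  are dominated by \<open>lerch_weight a b t / (d * d)\<close>, where d bounds both denominators
  from below.\<close>

lemma lerch_integral_holomorphic:
  assumes "a > 0" "b > 0"
  shows "lerch_integral a b holomorphic_on (- complex_of_real ` {1..})"
proof -
  have "lerch_integral a b field_differentiable at z" if z: "z \<in> - complex_of_real ` {1..}" for z
  proof -
    obtain d e where de: "d > 0" "e > 0"
      and lower: "\<And>w s. dist z w < e \<Longrightarrow> s \<in> {0..1} \<Longrightarrow> d \<le> norm (1 - w * complex_of_real s)"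
      using one_minus_scaled_norm_lower_bound[OF z] by metis
    have lower': "d \<le> norm (1 - w * complex_of_real (exp (- t)))" if "dist z w < e" "t > 0" for w t
      using lower[OF that(1), of "exp (- t)"] that(2) by simp
    have int: "integrable lborel (lerch_kernel a b w)" if "dist z w < e" for w
    proof (rule Bochner_Integration.integrable_bound)
      show "integrable lborel (\<lambda>t. lerch_weight a b t / d)"
        using assms by (intro integrable_divide integrable_lerch_weight)
      show "AE t in lborel. norm (lerch_kernel a b w t) \<le> norm (lerch_weight a b t / d)"
      proof (intro AE_I2)
        fix t
        show "norm (lerch_kernel a b w t) \<le> norm (lerch_weight a b t / d)"
        proof (cases "t > 0")
          case True
          then show ?thesis using lower'[OF that True] de
            by (auto simp: lerch_kernel_def norm_divide lerch_weight_nonneg intro!: frac_le)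
        qed (simp add: lerch_kernel_def lerch_weight_def)
      qed
    qed auto
    \<comment> \<open>The difference quotient of the kernel with w - z cancelled, so that it also
      makes sense at w = z, where it is the derivative.\<close>
    define q where "q w t = of_real (lerch_weight a b t * exp (- t)) /
        ((1 - w * complex_of_real (exp (- t))) * (1 - z * complex_of_real (exp (- t))))" for w t
    have quot: "(lerch_kernel a b w t - lerch_kernel a b z t) / (w - z) = q w t"
      if "dist z w < e" "w \<noteq> z" for w t
    proof (cases "t > 0")
      case True
      have "1 - w * complex_of_real (exp (- t)) \<noteq> 0" "1 - z * complex_of_real (exp (- t)) \<noteq> 0"
        using lower'[OF that(1) True] lower'[of z t] True de by auto
      then show ?thesis using that(2)
        by (simp add: lerch_kernel_def q_def divide_simps) (simp add: algebra_simps)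
    qed (simp add: lerch_kernel_def lerch_weight_def q_def)
    have "((\<lambda>w. \<integral>t. q w t \<partial>lborel) \<longlongrightarrow> (\<integral>t. q z t \<partial>lborel)) (at z)"
      unfolding tendsto_at_iff_sequentially
    proof (intro allI impI)
      fix X :: "nat \<Rightarrow> complex"
      assume "\<forall>i. X i \<in> UNIV - {z}" and lim: "X \<longlonglongrightarrow> z"
      then obtain N where N: "\<And>n. n \<ge> N \<Longrightarrow> dist (X n) z < e"
        using \<open>e > 0\<close> by (metis lim_sequentially)
      \<comment> \<open>Dropping the first N terms keeps the whole sequence in the e-ball around z,
        where the majorant is valid.\<close>
      have "(\<lambda>n. \<integral>t. q (X (n + N)) t \<partial>lborel) \<longlonglongrightarrow> (\<integral>t. q z t \<partial>lborel)"
      proof (rule integral_dominated_convergence)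
        show "integrable lborel (\<lambda>t. lerch_weight a b t / (d * d))"
          using assms by (intro integrable_divide integrable_lerch_weight)
        show "AE t in lborel. (\<lambda>n. q (X (n + N)) t) \<longlonglongrightarrow> q z t"
        proof (intro AE_I2)
          fix t
          show "(\<lambda>n. q (X (n + N)) t) \<longlonglongrightarrow> q z t"
          proof (cases "t > 0")
            case True
            have "1 - z * complex_of_real (exp (- t)) \<noteq> 0"
              using lower'[of z t] True de by auto
            then show ?thesis unfolding q_def
              by (intro tendsto_intros LIMSEQ_ignore_initial_segment lim) auto
          qed (simp add: q_def lerch_weight_def)
        qed
        show "AE t in lborel. norm (q (X (n + N)) t) \<le> lerch_weight a b t / (d * d)" for n
        proof (intro AE_I2)
          fix t
          show "norm (q (X (n + N)) t) \<le> lerch_weight a b t / (d * d)"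
          proof (cases "t > 0")
            case True
            have "lerch_weight a b t * exp (- t) \<le> lerch_weight a b t * 1"
              using True lerch_weight_nonneg by (intro mult_left_mono) auto
            then show ?thesis using lower'[of "X (n + N)" t] lower'[of z t] True N[of "n + N"] de
              unfolding q_def norm_divide norm_mult
              by (intro frac_le mult_mono) (auto simp: dist_commute norm_mult abs_mult lerch_weight_nonneg)
          qed (simp add: q_def lerch_weight_def)
        qed
      qed (auto simp: q_def[abs_def])
      then show "((\<lambda>w. \<integral>t. q w t \<partial>lborel) \<circ> X) \<longlonglongrightarrow> (\<integral>t. q z t \<partial>lborel)"
        unfolding o_def by (rule LIMSEQ_offset)
    qed
    then have "((\<lambda>w. ((\<integral>t. lerch_kernel a b w t \<partial>lborel) - (\<integral>t. lerch_kernel a b z t \<partial>lborel)) / (w - z))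
                 \<longlongrightarrow> (\<integral>t. q z t \<partial>lborel)) (at z)"
    proof (rule Lim_transform_within)
      show "0 < e" by fact
      fix w assume w: "0 < dist w z" "dist w z < e"
      then have "w \<noteq> z" "dist z w < e" by (auto simp: dist_commute)
      then show "(\<integral>t. q w t \<partial>lborel) =
          ((\<integral>t. lerch_kernel a b w t \<partial>lborel) - (\<integral>t. lerch_kernel a b z t \<partial>lborel)) / (w - z)"
        using int[of w] int[of z] \<open>e > 0\<close> by (simp flip: quot)
    qed
    then have "((\<lambda>w. \<integral>t. lerch_kernel a b w t \<partial>lborel) has_field_derivative (\<integral>t. q z t \<partial>lborel)) (at z)"
      by (simp add: has_field_derivative_iff)
    then show ?thesis
      unfolding lerch_integral_def[abs_def] field_differentiable_def by (auto intro!: exI DERIV_cdivide)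
  qed
  then show ?thesis
    unfolding holomorphic_on_def by (blast intro: field_differentiable_at_within)
qed

section \<open>Identification with the analytic continuation, and boundary values\<close>

lemma slit_plane_open_connected:
  "open (- complex_of_real ` {1..})" "connected (- complex_of_real ` {1..})"
proof -
  show "open (- complex_of_real ` {1..})"
    by (intro open_Compl closed_injective_linear_image) (auto simp: inj_def bounded_linear.linear bounded_linear_of_real)
  have "starlike (- complex_of_real ` {1..})"
    unfolding starlike_def
  proof (intro bexI[of _ 0] ballI subsetI)
    fix x y assume x: "x \<in> - complex_of_real ` {1..}" and y: "y \<in> closed_segment 0 x"
    from y obtain s where s: "s \<in> {0..1}" "y = s *\<^sub>R x" by (auto simp: closed_segment_def)
    show "y \<in> - complex_of_real ` {1..}"
    proof
      assume "y \<in> complex_of_real ` {1..}"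
      then obtain c where c: "c \<ge> 1" "s *\<^sub>R x = complex_of_real c" using s by auto
      then have "s \<noteq> 0" by auto
      with s c have "x = complex_of_real (c / s)" "c / s \<ge> 1"
        by (auto simp: field_simps scaleR_conv_of_real)
      with x show False by (metis ComplD atLeast_iff imageI)
    qed
  qed auto
  then show "connected (- complex_of_real ` {1..})"
    by (rule starlike_imp_connected)
qed

text \<open>For a \<le> 1 and \<open>norm z = 1\<close> the definition of \<open>lerch_Phi\<close>
  takes the continuation branch. The integral is one continuation, and the identity theorem on the
  slit plane makes any other agree with it.\<close>

lemma lerch_Phi_eq_integral:
  assumes "0 < a" "a \<le> 1" "b > 0" "norm z = 1" "z \<noteq> 1"
  shows "lerch_Phi z a b = lerch_integral a b z"
proof -
  let ?S = "- complex_of_real ` {1..}"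
  have z: "z \<in> ?S" using assms by auto
  have ball: "ball 0 1 \<subseteq> ?S" by auto
  have "(THE w. \<exists>g. g holomorphic_on ?S \<and>
             (\<forall>u. norm u < 1 \<longrightarrow> g u = lerch_series u a b) \<and> w = g z) = lerch_integral a b z"
  proof (rule the_equality)
    show "\<exists>g. g holomorphic_on ?S \<and>
             (\<forall>u. norm u < 1 \<longrightarrow> g u = lerch_series u a b) \<and> lerch_integral a b z = g z"
      using assms lerch_integral_holomorphic lerch_series_eq_integral by metis
    fix w assume "\<exists>g. g holomorphic_on ?S \<and> (\<forall>u. norm u < 1 \<longrightarrow> g u = lerch_series u a b) \<and> w = g z"
    then obtain g where g: "g holomorphic_on ?S" "\<And>u. norm u < 1 \<Longrightarrow> g u = lerch_series u a b" "w = g z"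
      by auto
    have "g z = lerch_integral a b z"
    proof (rule analytic_continuation_open[where f = g and g = "lerch_integral a b" and s = "ball 0 1" and s' = ?S])
      show "g u = lerch_integral a b u" if "u \<in> ball 0 1" for u
        using that g(2) assms by (simp add: lerch_series_eq_integral)
    qed (use slit_plane_open_connected g(1) assms ball z lerch_integral_holomorphic in auto)
    then show "w = lerch_integral a b z" using g by simp
  qed
  then show ?thesis using assms by (simp add: lerch_Phi_def)
qed

text \<open>The radial limit, split as in the definition of \<open>lerch_Phi\<close>. For a \<le> 1
  it is continuity of the integral at z, which lies off the cut; for a > 1 the series converges
  absolutely on the closed disc and Tannery's theorem applies.\<close>

lemma lerch_series_tendsto_Phi:
  fixes X :: "nat \<Rightarrow> real"
  assumes "a > 0" "b > 0" "norm z = 1" "z \<noteq> 1"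
    and X: "\<And>j. 0 \<le> X j" "\<And>j. X j < 1" "X \<longlonglongrightarrow> 1"
  shows "(\<lambda>j. lerch_series (of_real (X j) * z) a b) \<longlonglongrightarrow> lerch_Phi z a b"
proof -
  have Xz: "(\<lambda>j. of_real (X j) * z) \<longlonglongrightarrow> of_real 1 * z"
    by (intro tendsto_intros X)
  show ?thesis
  proof (cases "a \<le> 1")
    case True
    have "z \<in> - complex_of_real ` {1..}" using assms by auto
    then have "isCont (lerch_integral a b) z"
      using continuous_on_eq_continuous_at[OF slit_plane_open_connected(1), of "lerch_integral a b"]
        holomorphic_on_imp_continuous_on[OF lerch_integral_holomorphic[of a b]] assms by blast
    then have "(\<lambda>j. lerch_integral a b (of_real (X j) * z)) \<longlonglongrightarrow> lerch_integral a b z"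
      using Xz isCont_tendsto_compose by fastforce
    moreover have "norm (of_real (X j) * z) < 1" for j
      using X assms by (simp add: norm_mult)
    ultimately show ?thesis
      using assms True by (simp add: lerch_Phi_eq_integral lerch_series_eq_integral)
  next
    case False
    define M where "M n = 1 / (b + real n) powr a" for n
    have summ: "summable M"
    proof (rule summable_comparison_test_ev)
      show "summable (\<lambda>n. real n powr - a)"
        using False by (simp add: summable_real_powr_iff)
      \<comment> \<open>The bound fails at n = 0, where \<open>real n powr - a\<close> is 0 by
        convention.\<close>
      show "\<forall>\<^sub>F n in sequentially. norm (M n) \<le> real n powr - a"
        using eventually_gt_at_top[of 0] 
        by eventually_elim (use assms in \<open>auto simp: M_def powr_minus_divide intro!: frac_le powr_mono2\<close>)
    qed
    have "(\<lambda>j. \<Sum>n. (of_real (X j) * z) ^ n / complex_of_real (b + real n) powr complex_of_real a)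
             \<longlonglongrightarrow> (\<Sum>n. z ^ n / complex_of_real (b + real n) powr complex_of_real a)"
    proof (rule tannerys_theorem[THEN conjunct2, THEN conjunct2])
      show "(\<lambda>j. (of_real (X j) * z) ^ n / complex_of_real (b + real n) powr complex_of_real a)
             \<longlonglongrightarrow> z ^ n / complex_of_real (b + real n) powr complex_of_real a" for n
        using Xz assms by (intro tendsto_intros) (auto simp: powr_of_real simp del: of_real_add)
      show "\<forall>\<^sub>F (n, j) in at_top \<times>\<^sub>F sequentially.
          norm ((of_real (X j) * z) ^ n / complex_of_real (b + real n) powr complex_of_real a) \<le> M n"
      proof (intro always_eventually allI, clarify)
        fix n j
        have "\<bar>X j\<bar> ^ n \<le> 1" using X(1,2)[of j] by (intro power_le_one) (auto simp: less_imp_le)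
        then show "norm ((of_real (X j) * z) ^ n / complex_of_real (b + real n) powr complex_of_real a) \<le> M n"
          using assms by (auto simp: powr_of_real M_def norm_divide norm_mult norm_power
              simp del: of_real_add intro!: divide_right_mono)
      qed
    qed (use summ in auto)
    then show ?thesis using False assms by (simp add: lerch_Phi_def lerch_series_def)
  qed
qed

subsection \<open>A bound near the singularity\<close>

text \<open>From 1 - e^(-t) \<ge> t / (1 + t) and 1 + 1/t \<le> 2 max(1, 1/t), the extra factor is
  at most 2 (1 + t^(-\<delta>)). The term t^(-\<delta>) lowers the exponent a to a - \<delta>, which
  is still positive.\<close>

lemma integrable_lerch_weight_singular:
  fixes a b \<delta> :: real
  assumes "b > 0" "0 < \<delta>" "\<delta> < 1" "\<delta> < a"
  shows "integrable lborel (\<lambda>t. lerch_weight a b t * (1 - exp (- t)) powr (- \<delta>))"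
proof (rule Bochner_Integration.integrable_bound)
  show "integrable lborel (\<lambda>t. 2 * (lerch_weight a b t + lerch_weight (a - \<delta>) b t))"
    using assms by (intro integrable_mult_right Bochner_Integration.integrable_add integrable_lerch_weight) auto
  show "AE t in lborel. norm (lerch_weight a b t * (1 - exp (- t)) powr (- \<delta>))
          \<le> norm (2 * (lerch_weight a b t + lerch_weight (a - \<delta>) b t))"
  proof (intro AE_I2)
    fix t :: real
    show "norm (lerch_weight a b t * (1 - exp (- t)) powr (- \<delta>))
          \<le> norm (2 * (lerch_weight a b t + lerch_weight (a - \<delta>) b t))"
    proof (cases "t > 0")
      case True
      have "1 + t \<le> exp t" by (rule exp_ge_add_one_self)
      then have *: "t / (1 + t) \<le> 1 - exp (- t)"
        using True by (simp add: exp_minus field_simps)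
      have "(1 - exp (- t)) powr (- \<delta>) \<le> (t / (1 + t)) powr (- \<delta>)"
        using * True assms by (intro powr_mono2') auto
      also have "\<dots> = ((1 + t) / t) powr \<delta>"
        using True by (simp add: powr_minus powr_divide)
      also have "\<dots> \<le> (2 * max 1 (1 / t)) powr \<delta>"
        using True assms by (intro powr_mono2) (auto simp: field_simps max_def)
      also have "\<dots> = 2 powr \<delta> * max 1 (1 / t) powr \<delta>"
        by (intro powr_mult)
      also have "\<dots> \<le> 2 powr 1 * (1 + t powr (- \<delta>))"
        using True assms by (intro mult_mono powr_mono) (auto simp: max_def powr_divide powr_minus field_simps)
      finally have "lerch_weight a b t * (1 - exp (- t)) powr (- \<delta>) \<le>
          lerch_weight a b t * (2 * (1 + t powr (- \<delta>)))"
        by (intro mult_left_mono lerch_weight_nonneg) auto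
      also have "\<dots> = 2 * (lerch_weight a b t + lerch_weight (a - \<delta>) b t)"
        using True by (simp add: lerch_weight_def algebra_simps flip: powr_add)
      finally show ?thesis using lerch_weight_nonneg[of a b t] lerch_weight_nonneg[of "a - \<delta>" b t]
        by (simp add: abs_mult)
    qed (simp add: lerch_weight_def)
  qed
qed auto

text \<open>The distance c of 1 from the segment between 0 and u enters only through c^(\<delta>-1),
  with a factor that does not depend on u. With c = |cos \<phi>| this power is integrable over
  [0, pi], while 1/c is not.\<close>

lemma norm_lerch_series_le:
  fixes a b \<delta> c :: real and u :: complex
  assumes "b > 0" "0 < \<delta>" "\<delta> < 1" "\<delta> < a" "norm u < 1" "c > 0"
    and c: "\<And>s. s \<in> {0..1} \<Longrightarrow> c \<le> norm (1 - u * complex_of_real s)"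
  shows "norm (lerch_series u a b) \<le>
           (\<integral>t. lerch_weight a b t * (1 - exp (- t)) powr (- \<delta>) \<partial>lborel) / Gamma a * c powr (\<delta> - 1)"
proof -
  have pos: "Gamma a > 0" using assms by (intro Gamma_real_pos) auto
  have "norm (\<integral>t. lerch_kernel a b u t \<partial>lborel)
        \<le> (\<integral>t. lerch_weight a b t * (1 - exp (- t)) powr (- \<delta>) * c powr (\<delta> - 1) \<partial>lborel)"
  proof (rule order_trans[OF integral_norm_bound integral_mono'])
    show "integrable lborel (\<lambda>t. lerch_weight a b t * (1 - exp (- t)) powr (- \<delta>) * c powr (\<delta> - 1))"
      using assms by (intro integrable_mult_left integrable_lerch_weight_singular) auto
    fix t :: real
    show "0 \<le> lerch_weight a b t * (1 - exp (- t)) powr (- \<delta>) * c powr (\<delta> - 1)"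
      by (simp add: lerch_weight_nonneg)
    show "norm (lerch_kernel a b u t)
      \<le> lerch_weight a b t * (1 - exp (- t)) powr (- \<delta>) * c powr (\<delta> - 1)"
    proof (cases "t > 0")
      case True
      define D where "D = norm (1 - u * complex_of_real (exp (- t)))"
      have "D \<ge> c" using c[of "exp (- t)"] True by (simp add: D_def)
      have "norm (u * complex_of_real (exp (- t))) \<le> 1 * exp (- t)"
        unfolding norm_mult using assms by (intro mult_mono) auto
      then have "D \<ge> 1 - exp (- t)"
        using norm_triangle_ineq2[of 1 "u * complex_of_real (exp (- t))"] by (simp add: D_def)
      \<comment> \<open>Write D = D^\<delta> D^(1-\<delta>) and use one lower bound of D in each
        factor.\<close>
      have "(1 - exp (- t)) powr \<delta> * c powr (1 - \<delta>) \<le> D powr \<delta> * D powr (1 - \<delta>)"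
        using \<open>D \<ge> c\<close> \<open>D \<ge> 1 - exp (- t)\<close> assms True by (intro mult_mono powr_mono2) auto
      also have "\<dots> = D" using \<open>D \<ge> c\<close> \<open>c > 0\<close> by (simp flip: powr_add)
      finally have "1 / D \<le> 1 / ((1 - exp (- t)) powr \<delta> * c powr (1 - \<delta>))"
        using \<open>D \<ge> c\<close> \<open>c > 0\<close> True by (intro frac_le) auto
      also have "\<dots> = (1 - exp (- t)) powr (- \<delta>) * c powr (\<delta> - 1)"
        using powr_minus[of c "1 - \<delta>"] by (simp add: powr_minus divide_inverse)
      finally have "lerch_weight a b t * (1 / D) \<le> lerch_weight a b t * ((1 - exp (- t)) powr (- \<delta>) * c powr (\<delta> - 1))"
        by (intro mult_left_mono lerch_weight_nonneg)
      then show ?thesis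
        by (simp add: lerch_kernel_def norm_divide lerch_weight_nonneg D_def mult.assoc)
    qed (simp add: lerch_kernel_def lerch_weight_def)
  qed
  then show ?thesis
    using assms pos
    by (simp add: lerch_series_eq_integral lerch_integral_def norm_divide divide_right_mono)
qed

text \<open>The squared norm equals (1 - s)^2 + 4 s cos^2 \<phi>. If s \<ge> 1/4 the second term
  suffices; otherwise (1 - s)^2 \<ge> 1 - 4 s \<ge> (1 - 4 s) cos^2 \<phi> makes up the
  difference.\<close>

lemma abs_cos_le_norm_one_plus:
  fixes \<phi> s :: real
  assumes "0 \<le> s" "s \<le> 1"
  shows "\<bar>cos \<phi>\<bar> \<le> norm (1 + complex_of_real s * cis (2 * \<phi>))"
proof -
  have eq: "(norm (1 + complex_of_real s * cis (2 * \<phi>)))\<^sup>2 = (1 - s)\<^sup>2 + 4 * s * (cos \<phi>)\<^sup>2"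
  proof -
    have "(norm (1 + complex_of_real s * cis (2 * \<phi>)))\<^sup>2 =
          1 + 2 * s * cos (2 * \<phi>) + s\<^sup>2 * ((sin (2 * \<phi>))\<^sup>2 + (cos (2 * \<phi>))\<^sup>2)"
      unfolding cmod_power2 by (simp add: power2_sum power_mult_distrib distrib_left del: sin_cos_squared_add)
    also have "\<dots> = (1 - s)\<^sup>2 + 4 * s * (cos \<phi>)\<^sup>2"
      unfolding sin_cos_squared_add unfolding cos_double_cos by (simp add: power2_eq_square algebra_simps)
    finally show ?thesis .
  qed
  have "(cos \<phi>)\<^sup>2 \<le> (1 - s)\<^sup>2 + 4 * s * (cos \<phi>)\<^sup>2"
  proof (cases "s \<ge> 1 / 4")
    case True
    then have "1 * (cos \<phi>)\<^sup>2 \<le> 4 * s * (cos \<phi>)\<^sup>2" by (intro mult_right_mono) auto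
    then show ?thesis by (simp add: add_increasing)
  next
    case False
    have "(cos \<phi>)\<^sup>2 \<le> 1" by (simp add: abs_square_le_1)
    then have "(1 - 4 * s) * (cos \<phi>)\<^sup>2 \<le> (1 - 4 * s) * 1"
      using False by (intro mult_left_mono) auto
    also have "\<dots> \<le> (1 - s)\<^sup>2" using assms by (simp add: power2_eq_square algebra_simps)
    finally show ?thesis by (simp add: algebra_simps)
  qed
  then show ?thesis
    unfolding eq [symmetric] using abs_le_square_iff by force
qed

text \<open>Jordan's inequality sin y \<ge> 2 y / pi on [0, pi/2], applied to y = |x -
  pi/2|.\<close>

lemma abs_cos_ge_linear:
  fixes x :: real
  assumes "x \<in> {0..pi}"
  shows "\<bar>cos x\<bar> \<ge> 2 / pi * \<bar>x - pi / 2\<bar>"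
proof -
  have *: "2 / pi * y \<le> sin y" if "0 \<le> y" "y \<le> pi / 2" for y :: real
  proof -
    have "concave_on {0..pi / 2} sin"
    proof -
      have "convex_on {0..pi / 2} (\<lambda>x. - sin x :: real)"
        by (rule f''_ge0_imp_convex[where f' = "\<lambda>x. - cos x" and f'' = sin])
           (auto intro!: derivative_eq_intros sin_ge_zero)
      then show ?thesis by (simp add: concave_on_def)
    qed
    \<comment> \<open>Concavity along the chord from 0 to pi/2; the weight 2 y / pi on the right
      endpoint yields the point y.\<close>
    then have "(1 - 2 / pi * y) * sin 0 + 2 / pi * y * sin (pi / 2) \<le> sin ((1 - 2 / pi * y) *\<^sub>R 0 + (2 / pi * y) *\<^sub>R (pi / 2))"
      using that pi_gt_zero by (intro concave_onD) (auto simp: field_simps)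
    then show ?thesis by simp
  qed
  show ?thesis
  proof (cases "x \<le> pi / 2")
    case True
    with assms have "2 / pi * (pi / 2 - x) \<le> sin (pi / 2 - x)" by (intro *) auto
    also have "\<dots> \<le> \<bar>cos x\<bar>" by (simp add: sin_diff)
    finally show ?thesis using True by (simp add: abs_of_nonpos)
  next
    case False
    with assms have "2 / pi * (x - pi / 2) \<le> sin (x - pi / 2)" by (intro *) auto
    also have "\<dots> \<le> \<bar>cos x\<bar>" by (simp add: sin_diff)
    finally show ?thesis using False by simp
  qed
qed

text \<open>The antiderivative settles [0, N] and reflection settles [-N, 0]; N is chosen so that
  the two intervals cover \<open>{c..d}\<close>.\<close>

lemma set_integrable_abs_powr:
  fixes p c d :: real
  assumes "p > -1"
  shows "set_integrable lborel {c..d} (\<lambda>x. \<bar>x\<bar> powr p)"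
proof -
  define N where "N = max \<bar>c\<bar> \<bar>d\<bar>"
  have "(\<lambda>x. x powr p) integrable_on {0..N}"
    using has_integral_powr_from_0[of p N] assms by (auto simp: N_def le_max_iff_disj intro: has_integral_integrable)
  then have "set_integrable lebesgue {0..N} (\<lambda>x. x powr p)"
    by (intro nonnegative_absolutely_integrable_1) auto
  then have 1: "integrable lborel (\<lambda>x. indicator {0..N} x * x powr p)"
    by (simp add: set_integrable_def integrable_completion)
  from lborel_integrable_real_affine[OF this, of "-1" 0]
  have "integrable lborel (\<lambda>x. indicator {0..N} (- x) * (- x) powr p)" by simp
  from Bochner_Integration.integrable_add[OF 1 this] show ?thesis
    unfolding set_integrable_def
    by (rule Bochner_Integration.integrable_bound) (auto simp: indicator_def N_def)
qed

text \<open>As p \<le> 0, the linear lower bound for |cos x| becomes an upper bound for its power.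
  The zero pi/2 of the cosine is discarded as a null set.\<close>

lemma set_integrable_abs_cos_powr:
  fixes p :: real
  assumes "-1 < p" "p \<le> 0"
  shows "set_integrable lborel {0..pi} (\<lambda>x. \<bar>cos x\<bar> powr p)"
proof -
  have "integrable lborel (\<lambda>x. indicator {- (pi / 2)..pi / 2} x * \<bar>x\<bar> powr p)"
    using set_integrable_abs_powr[OF assms(1)] by (simp add: set_integrable_def)
  from lborel_integrable_real_affine[OF this, of 1 "- (pi / 2)"]
  have "integrable lborel (\<lambda>x. (2 / pi) powr p * (indicator {- (pi / 2)..pi / 2} (x - pi / 2) * \<bar>x - pi / 2\<bar> powr p))"
    by (intro integrable_mult_right) (simp add: algebra_simps)
  then show ?thesis unfolding set_integrable_def
  proof (rule Bochner_Integration.integrable_bound)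
    show "AE x in lborel. norm (indicat_real {0..pi} x *\<^sub>R \<bar>cos x\<bar> powr p)
        \<le> norm ((2 / pi) powr p * (indicator {- (pi / 2)..pi / 2} (x - pi / 2) * \<bar>x - pi / 2\<bar> powr p))"
      using AE_lborel_singleton[of "pi / 2"]
    proof eventually_elim
      case (elim x)
      show ?case
      proof (cases "x \<in> {0..pi}")
        case True
        have "\<bar>cos x\<bar> powr p \<le> (2 / pi * \<bar>x - pi / 2\<bar>) powr p"
          using abs_cos_ge_linear[OF True] assms elim by (intro powr_mono2') auto
        also have "\<dots> = (2 / pi) powr p * \<bar>x - pi / 2\<bar> powr p"
          by (intro powr_mult)
        finally show ?thesis using True by (simp add: indicator_def)
      qed (auto simp: indicator_def)
    qed
  qed auto
qed

subsection \<open>Termwise integration\<close>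

text \<open>The Weierstrass M-test for integrals: the integral of \<open>norm (f n x)\<close> is at
  most \<open>M n\<close> times the length of the interval. All later exchanges of a sum with an
  integral go through this lemma.\<close>

lemma set_integral_sums:
  fixes f :: "nat \<Rightarrow> real \<Rightarrow> 'a :: {banach, second_countable_topology}" and h :: "real \<Rightarrow> 'a"
  assumes cont: "\<And>n. continuous_on {a..b} (f n)"
    and bound: "\<And>n x. x \<in> {a..b} \<Longrightarrow> norm (f n x) \<le> M n"
    and "summable M" and sums: "\<And>x. x \<in> {a..b} \<Longrightarrow> (\<lambda>n. f n x) sums h x"
  shows "set_integrable lborel {a..b} h"
    and "(\<lambda>n. LBINT x:{a..b}. f n x) sums (LBINT x:{a..b}. h x)"
proof -
  define f' where "f' n x = indicator {a..b} x *\<^sub>R f n x" for n x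
  have int: "integrable lborel (f' n)" for n
    using borel_integrable_atLeastAtMost'[OF cont, of n]
    by (simp add: set_integrable_def f'_def[abs_def])
  have bound': "norm (f' n x) \<le> indicator {a..b} x * M n" for n x
    using bound[of x n] by (auto simp: f'_def indicator_def)
  have summable_f': "summable (\<lambda>n. norm (f' n x))" for x
    by (rule summable_comparison_test'[OF summable_mult[OF \<open>summable M\<close>]]) (use bound'[of _ x] in simp)
  have "summable (\<lambda>n. \<integral>x. norm (f' n x) \<partial>lborel)"
  proof (rule summable_comparison_test'[OF summable_mult[OF \<open>summable M\<close>, of "measure lborel {a..b}"]])
    fix n :: nat
    have "(\<integral>x. norm (f' n x) \<partial>lborel) \<le> (\<integral>x. indicator {a..b} x * M n \<partial>lborel)"
      using int bound' by (intro integral_mono integrable_mult_left integrable_norm) (auto simp: emeasure_lborel_Icc_eq)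
    then show "norm (\<integral>x. norm (f' n x) \<partial>lborel) \<le> measure lborel {a..b} * M n"
      by simp
  qed
  note * = int AE_I2[OF summable_f'] this
  have h: "(\<lambda>x. \<Sum>n. f' n x) = (\<lambda>x. indicator {a..b} x *\<^sub>R h x)"
    using sums by (auto simp: fun_eq_iff f'_def sums_iff indicator_def)
  show "set_integrable lborel {a..b} h"
    unfolding set_integrable_def h [symmetric] by (rule integrable_suminf[OF *])
  show "(\<lambda>n. LBINT x:{a..b}. f n x) sums (LBINT x:{a..b}. h x)"
    unfolding set_lebesgue_integral_def h [symmetric] using sums_integral[OF *] by (simp add: f'_def)
qed

text \<open>The Abel means of the cosine series of \<^const>\<open>F\<close>.\<close>

definition F_abel :: "real \<Rightarrow> real \<Rightarrow> nat \<Rightarrow> real \<Rightarrow> real \<Rightarrow> complex" where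
  "F_abel \<alpha> \<beta> \<mu> s \<phi> =
     - (1 / 2) * (cis (\<phi> * real (\<mu> + 2)) * lerch_series (of_real s * - cis (2 * \<phi>)) \<alpha> (\<beta> + 1) +
        cis (- (\<phi> * real (\<mu> + 2))) * lerch_series (of_real s * - cis (- (2 * \<phi>))) \<alpha> (\<beta> + 1))"

text \<open>Multiplying out the prefactor, e^(-iy) e^(2iy) = e^(iy), puts \<open>F\<close> into the
  shape of \<open>F_abel\<close> with s = 1 and \<open>lerch_Phi\<close> for the series.\<close>

lemma F_conv_cis:
  "F \<alpha> \<beta> \<mu> \<phi> =
     - (1 / 2) * (cis (\<phi> * real (\<mu> + 2)) * lerch_Phi (- cis (2 * \<phi>)) \<alpha> (\<beta> + 1) +
        cis (- (\<phi> * real (\<mu> + 2))) * lerch_Phi (- cis (- (2 * \<phi>))) \<alpha> (\<beta> + 1))"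
proof -
  define y where "y = \<phi> * real (\<mu> + 2)"
  have 1: "exp (2 * \<i> * of_real \<phi>) = cis (2 * \<phi>)" "exp (- 2 * \<i> * of_real \<phi>) = cis (- (2 * \<phi>))"
    by (simp_all add: cis_conv_exp mult_ac)
  have 2: "exp (- \<i> * of_real \<phi> * of_nat (\<mu> + 2)) = cis (- y)"
    by (simp add: y_def cis_conv_exp mult_ac)
  have 3: "exp (2 * \<i> * of_real \<phi> * of_nat (\<mu> + 2)) = cis (2 * y)"
    by (simp add: y_def cis_conv_exp mult_ac)
  have 4: "cis (- y) * (cis (2 * y) * w) = cis y * w" for w
    by (simp add: cis_mult flip: mult.assoc)
  show ?thesis
    unfolding F_def 1 2 3 y_def [symmetric] by (simp add: distrib_left mult.assoc 4)
qed

text \<open>Either equality would force cos(2 \<phi>) = -1, hence cos \<phi> = 0. This keeps both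
  arguments of \<open>lerch_Phi\<close> away from its singular point 1.\<close>

lemma neg_cis_double_neq_1:
  assumes "\<phi> \<in> {0..pi}" "\<phi> \<noteq> pi / 2"
  shows "- cis (2 * \<phi>) \<noteq> 1" "- cis (- (2 * \<phi>)) \<noteq> 1"
proof -
  have "cos \<phi> \<noteq> 0"
    using assms abs_cos_ge_linear[of \<phi>] pi_gt_zero by (auto simp: divide_le_0_iff)
  then have "cos (2 * \<phi>) \<noteq> -1"
    by (simp add: cos_double_cos)
  then show "- cis (2 * \<phi>) \<noteq> 1" "- cis (- (2 * \<phi>)) \<noteq> 1"
    by (auto simp: complex_eq_iff)
qed

lemma F_abel_tendsto:
  fixes X :: "nat \<Rightarrow> real"
  assumes "\<alpha> > 0" "\<beta> > -1" "\<phi> \<in> {0..pi}" "\<phi> \<noteq> pi / 2"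
    and "\<And>j. 0 \<le> X j" "\<And>j. X j < 1" "X \<longlonglongrightarrow> 1"
  shows "(\<lambda>j. F_abel \<alpha> \<beta> \<mu> (X j) \<phi>) \<longlonglongrightarrow> F \<alpha> \<beta> \<mu> \<phi>"
  unfolding F_abel_def F_conv_cis using assms neg_cis_double_neq_1[OF assms(3,4)]
  by (intro tendsto_intros lerch_series_tendsto_Phi) auto

text \<open>K depends neither on s nor on \<phi>, so one integrable function dominates all Abel
  means when s tends to 1.\<close>

lemma F_abel_bound:
  assumes "\<beta> > -1" "0 < \<delta>" "\<delta> < 1" "\<delta> < \<alpha>"
  shows "\<exists>K. \<forall>s \<phi>. 0 \<le> s \<longrightarrow> s < 1 \<longrightarrow> cos \<phi> \<noteq> 0 \<longrightarrow>
                     norm (F_abel \<alpha> \<beta> \<mu> s \<phi>) \<le> K * \<bar>cos \<phi>\<bar> powr (\<delta> - 1)"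
proof -
  define K where "K = (\<integral>t. lerch_weight \<alpha> (\<beta> + 1) t * (1 - exp (- t)) powr (- \<delta>) \<partial>lborel) / Gamma \<alpha>"
  have L: "norm (lerch_series (of_real s * - cis (2 * \<phi>)) \<alpha> (\<beta> + 1)) \<le> K * \<bar>cos \<phi>\<bar> powr (\<delta> - 1)"
    if s: "0 \<le> s" "s < 1" and \<phi>: "cos \<phi> \<noteq> 0" for s \<phi>
    unfolding K_def
  proof (rule norm_lerch_series_le)
    fix x :: real assume x: "x \<in> {0..1}"
    \<comment> \<open>The product s x lies in [0, 1] again, so it plays the role of s in
      \<open>abs_cos_le_norm_one_plus\<close>.\<close>
    then show "\<bar>cos \<phi>\<bar> \<le> norm (1 - complex_of_real s * - cis (2 * \<phi>) * complex_of_real x)"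
      using abs_cos_le_norm_one_plus[of "s * x" \<phi>] s mult_mono[of s 1 x 1] by (simp add: mult_ac)
  qed (use assms s \<phi> in \<open>auto simp: norm_mult\<close>)
  show ?thesis
  proof (intro exI allI impI)
    fix s \<phi> :: real assume *: "0 \<le> s" "s < 1" "cos \<phi> \<noteq> 0"
    have "norm (F_abel \<alpha> \<beta> \<mu> s \<phi>) \<le>
        1 / 2 * (norm (lerch_series (of_real s * - cis (2 * \<phi>)) \<alpha> (\<beta> + 1)) +
                 norm (lerch_series (of_real s * - cis (- (2 * \<phi>))) \<alpha> (\<beta> + 1)))"
      unfolding F_abel_def norm_mult
      by (intro mult_mono norm_triangle_le) (auto simp: norm_mult)
    \<comment> \<open>The second series is the first at -\<phi>, and the cosine is even; the two
      halves add up to one K.\<close>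
    also have "\<dots> \<le> K * \<bar>cos \<phi>\<bar> powr (\<delta> - 1)"
      using L[OF *] L[of s "- \<phi>"] * by simp
    finally show "norm (F_abel \<alpha> \<beta> \<mu> s \<phi>) \<le> K * \<bar>cos \<phi>\<bar> powr (\<delta> - 1)" .
  qed
qed

text \<open>The n-th terms of the two Lerch series carry e^(ix) and e^(-ix) with x = (2n + 2 +
  \<mu>) \<phi> and add up to a cosine. The leading factor -1/2 turns the sign (-1)^n into
  \<open>(-1) ^ Suc n\<close>; n corresponds to l = n + 1.\<close>

lemma F_abel_sums:
  assumes "\<alpha> > 0" "\<beta> > -1" "0 \<le> s" "s < 1"
  shows "(\<lambda>n. of_real ((-1) ^ Suc n * cos (real (2 * n + 2 + \<mu>) * \<phi>)) *
               of_real (s ^ n / (real (n + 1) + \<beta>) powr \<alpha>)) sums F_abel \<alpha> \<beta> \<mu> s \<phi>"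
proof -
  define a where "a n = 1 / complex_of_real ((\<beta> + 1 + real n) powr \<alpha>)" for n
  have L: "(\<lambda>n. u ^ n * a n) sums lerch_series u \<alpha> (\<beta> + 1)" if "norm u < 1" for u
  proof -
    have "summable (\<lambda>n. u ^ n * a n)"
    proof (rule summable_norm_cancel, rule summable_comparison_test')
      show "summable (\<lambda>n. norm u ^ n * (1 / (\<beta> + 1) powr \<alpha>))"
        using that by (intro summable_mult2 summable_geometric) auto
      fix n :: nat
      have "1 / (\<beta> + 1 + real n) powr \<alpha> \<le> 1 / (\<beta> + 1) powr \<alpha>"
        using assms by (intro frac_le powr_mono2) auto
      then show "norm (norm (u ^ n * a n)) \<le> norm u ^ n * (1 / (\<beta> + 1) powr \<alpha>)"
        by (simp add: norm_mult norm_power a_def norm_divide del: of_real_add) (use mult_left_mono[of _ _ "norm u ^ n"] in fastforce)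
    qed
    moreover have "u ^ n * a n = u ^ n / complex_of_real (\<beta> + 1 + real n) powr complex_of_real \<alpha>" for n
      using assms by (simp add: a_def powr_of_real del: of_real_add)
    ultimately show ?thesis
      by (simp add: lerch_series_def summable_sums)
  qed
  have "(\<lambda>n. - (1 / 2) * (cis (\<phi> * real (\<mu> + 2)) * ((of_real s * - cis (2 * \<phi>)) ^ n * a n) +
           cis (- (\<phi> * real (\<mu> + 2))) * ((of_real s * - cis (- (2 * \<phi>))) ^ n * a n)))
        sums F_abel \<alpha> \<beta> \<mu> s \<phi>"
    unfolding F_abel_def using assms
    by (intro sums_mult sums_add L) (auto simp: norm_mult)
  moreover have "- (1 / 2) * (cis (\<phi> * real (\<mu> + 2)) * ((of_real s * - cis (2 * \<phi>)) ^ n * a n) +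
           cis (- (\<phi> * real (\<mu> + 2))) * ((of_real s * - cis (- (2 * \<phi>))) ^ n * a n))
      = of_real ((-1) ^ Suc n * cos (real (2 * n + 2 + \<mu>) * \<phi>)) *
               of_real (s ^ n / (real (n + 1) + \<beta>) powr \<alpha>)" for n
  proof -
    define x where "x = real (2 * n + 2 + \<mu>) * \<phi>"
    have e: "\<phi> * real (\<mu> + 2) + real n * (2 * \<phi>) = x"
      "- (\<phi> * real (\<mu> + 2)) + real n * (- (2 * \<phi>)) = - x"
      by (simp_all add: x_def algebra_simps)
    have p: "(of_real s * - w) ^ n = of_real ((-1) ^ n * s ^ n) * w ^ n" for w :: complex
      by (simp add: power_mult_distrib power_minus[of w] power_minus[of "of_real s * w"])
    have c: "cis x + cis (- x) = 2 * of_real (cos x)"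
      by (simp add: complex_eq_iff)
    have "- (1 / 2) * (cis (\<phi> * real (\<mu> + 2)) * ((of_real s * - cis (2 * \<phi>)) ^ n * a n) +
           cis (- (\<phi> * real (\<mu> + 2))) * ((of_real s * - cis (- (2 * \<phi>))) ^ n * a n))
         = - (1 / 2) * of_real ((-1) ^ n * s ^ n) * a n *
            (cis (\<phi> * real (\<mu> + 2)) * cis (2 * \<phi>) ^ n + cis (- (\<phi> * real (\<mu> + 2))) * cis (- (2 * \<phi>)) ^ n)"
      unfolding p by (simp add: algebra_simps)
    also have "\<dots> = - (1 / 2) * of_real ((-1) ^ n * s ^ n) * a n * (cis x + cis (- x))"
      unfolding Complex.DeMoivre cis_mult e ..
    also have "\<dots> = of_real ((-1) ^ Suc n * cos x) * of_real (s ^ n / (real (n + 1) + \<beta>) powr \<alpha>)"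
      unfolding c by (simp add: a_def add_ac)
    finally show ?thesis unfolding x_def .
  qed
  ultimately show ?thesis by simp
qed

text \<open>For s < 1 the cosine series converges geometrically and may be integrated against g term
  by term. As s tends to 1, dominated convergence handles the integral and Tannery's theorem the
  series; the latter uses that the coefficients c n are absolutely summable.\<close>

lemma F_integral:
  fixes g :: "real \<Rightarrow> complex"
  assumes "\<alpha> > 0" "\<beta> > -1"
    and cont: "continuous_on {0..pi} g"
    and c: "\<And>n. (LBINT \<phi>:{0..pi}. g \<phi> * of_real ((-1) ^ Suc n * cos (real (2 * n + 2 + \<mu>) * \<phi>))) = c n"
    and summable: "summable (\<lambda>n. norm (c n))"
  shows "set_integrable lborel {0..pi} (\<lambda>\<phi>. g \<phi> * F \<alpha> \<beta> \<mu> \<phi>)"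
    and "(\<lambda>n. c n / of_real ((real (n + 1) + \<beta>) powr \<alpha>)) sums
           (LBINT \<phi>:{0..pi}. g \<phi> * F \<alpha> \<beta> \<mu> \<phi>)"
proof -
  \<comment> \<open>A concrete sequence in [0, 1) with limit 1, since the dominated convergence
    theorem is applied to sequences.\<close>
  define X where "X j = real j / real (Suc j)" for j
  have X: "0 \<le> X j" "X j < 1" for j by (auto simp: X_def)
  have X_lim: "X \<longlonglongrightarrow> 1" unfolding X_def by (rule LIMSEQ_n_over_Suc_n)
  define p where "p n = (real (n + 1) + \<beta>) powr \<alpha>" for n
  have p: "p n > 0" "p 0 \<le> p n" for n
    using assms by (auto simp: p_def intro!: powr_mono2)
  have "bounded (g ` {0..pi})"
    by (intro compact_imp_bounded compact_continuous_image cont) auto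
  then obtain G where "\<forall>y\<in>g ` {0..pi}. norm y \<le> G"
    unfolding bounded_iff ..
  then have G: "norm (g x) \<le> G" if "x \<in> {0..pi}" for x
    using that by blast
  have "G \<ge> 0" using order_trans[OF norm_ge_zero G[of 0]] by simp

  have abel: "set_integrable lborel {0..pi} (\<lambda>\<phi>. g \<phi> * F_abel \<alpha> \<beta> \<mu> s \<phi>)"
      "(\<lambda>n. c n * of_real (s ^ n / p n)) sums (LBINT \<phi>:{0..pi}. g \<phi> * F_abel \<alpha> \<beta> \<mu> s \<phi>)"
    if s: "0 \<le> s" "s < 1" for s
  proof -
    define f where "f n \<phi> = g \<phi> * (of_real ((-1) ^ Suc n * cos (real (2 * n + 2 + \<mu>) * \<phi>)) * of_real (s ^ n / p n))" for n \<phi>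
    have 1: "continuous_on {0..pi} (f n)" for n
      unfolding f_def by (intro continuous_intros cont)
    have 2: "norm (f n \<phi>) \<le> G * (s ^ n / p 0)" if "\<phi> \<in> {0..pi}" for n \<phi>
    proof -
      have "norm (f n \<phi>) = norm (g \<phi>) * (\<bar>cos (real (2 * n + 2 + \<mu>) * \<phi>)\<bar> * (s ^ n / p n))"
        using s p(1)[of n] by (simp add: f_def norm_mult norm_divide norm_power abs_mult)
      also have "\<dots> \<le> G * (1 * (s ^ n / p 0))"
        using G[OF that] \<open>G \<ge> 0\<close> s p(1)[of n] p(1)[of 0] p(2)[of n]
        by (intro mult_mono frac_le) auto
      finally show ?thesis by simp
    qed
    have 3: "summable (\<lambda>n. G * (s ^ n / p 0))"
      using s by (intro summable_mult summable_divide summable_geometric) auto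
    have 4: "(\<lambda>n. f n \<phi>) sums (g \<phi> * F_abel \<alpha> \<beta> \<mu> s \<phi>)" for \<phi>
      unfolding f_def p_def using assms s by (intro sums_mult F_abel_sums)
    have 5: "(LBINT \<phi>:{0..pi}. f n \<phi>) = c n * of_real (s ^ n / p n)" for n
      unfolding f_def mult.assoc[symmetric] c[symmetric]
      by (rule set_integral_mult_left)
    show "set_integrable lborel {0..pi} (\<lambda>\<phi>. g \<phi> * F_abel \<alpha> \<beta> \<mu> s \<phi>)"
      by (rule set_integral_sums(1)[OF 1 2 3 4])
    show "(\<lambda>n. c n * of_real (s ^ n / p n)) sums (LBINT \<phi>:{0..pi}. g \<phi> * F_abel \<alpha> \<beta> \<mu> s \<phi>)"
      using set_integral_sums(2)[OF 1 2 3 4] unfolding 5 .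
  qed

  \<comment> \<open>Any exponent strictly between 0 and min(1, \<alpha>) would do.\<close>
  define \<delta> where "\<delta> = min 1 \<alpha> / 2"
  have \<delta>: "0 < \<delta>" "\<delta> < 1" "\<delta> < \<alpha>" using assms by (auto simp: \<delta>_def)
  obtain K where K: "\<And>s \<phi>. 0 \<le> s \<Longrightarrow> s < 1 \<Longrightarrow> cos \<phi> \<noteq> 0 \<Longrightarrow>
                     norm (F_abel \<alpha> \<beta> \<mu> s \<phi>) \<le> K * \<bar>cos \<phi>\<bar> powr (\<delta> - 1)"
    using F_abel_bound[OF \<open>\<beta> > -1\<close> \<delta>, of \<mu>] by blast
  define s where "s j \<phi> = indicator {0..pi} \<phi> *\<^sub>R (g \<phi> * F_abel \<alpha> \<beta> \<mu> (X j) \<phi>)" for j \<phi>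
  define f where "f \<phi> = indicator {0..pi} \<phi> *\<^sub>R (g \<phi> * F \<alpha> \<beta> \<mu> \<phi>)" for \<phi>
  have lim: "(\<lambda>j. s j \<phi>) \<longlonglongrightarrow> f \<phi>" if "\<phi> \<noteq> pi / 2" for \<phi>
  proof (cases "\<phi> \<in> {0..pi}")
    case True
    then show ?thesis unfolding s_def f_def
      using that X X_lim assms by (intro tendsto_intros F_abel_tendsto) auto
  qed (simp add: s_def f_def)
  have int_s: "integrable lborel (s j)" for j
    using abel(1)[OF X, of j] by (simp add: s_def[abs_def] set_integrable_def)
  \<comment> \<open>Measurability of \<open>F\<close> is obtained from the Abel means: off the
    single point pi/2 the function f is their pointwise limit.\<close>
  have meas_f: "f \<in> borel_measurable lborel"
  proof (rule measurable_discrete_difference)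
    show "(\<lambda>\<phi>. if \<phi> = pi / 2 then 0 else f \<phi>) \<in> borel_measurable lborel"
    proof (rule borel_measurable_LIMSEQ_metric)
      show "(\<lambda>\<phi>. if \<phi> = pi / 2 then 0 else s j \<phi>) \<in> borel_measurable lborel" for j
        using borel_measurable_integrable[OF int_s, of j] by measurable
      show "(\<lambda>j. if \<phi> = pi / 2 then 0 else s j \<phi>) \<longlonglongrightarrow> (if \<phi> = pi / 2 then 0 else f \<phi>)" for \<phi>
        using lim[of \<phi>] by auto
    qed
    show "countable {pi / 2}" by simp
  qed auto
  have w: "integrable lborel (\<lambda>\<phi>. G * K * (indicator {0..pi} \<phi> * \<bar>cos \<phi>\<bar> powr (\<delta> - 1)))"
    using set_integrable_abs_cos_powr[of "\<delta> - 1"] \<delta>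
    by (intro integrable_mult_right) (simp add: set_integrable_def)
  have AE_lim: "AE \<phi> in lborel. (\<lambda>j. s j \<phi>) \<longlonglongrightarrow> f \<phi>"
    using AE_lborel_singleton[of "pi / 2"] by eventually_elim (rule lim)
  have AE_bound: "AE \<phi> in lborel. norm (s j \<phi>) \<le> G * K * (indicator {0..pi} \<phi> * \<bar>cos \<phi>\<bar> powr (\<delta> - 1))" for j
    using AE_lborel_singleton[of "pi / 2"]
  proof eventually_elim
    case (elim \<phi>)
    show ?case
    proof (cases "\<phi> \<in> {0..pi}")
      case True
      then have "cos \<phi> \<noteq> 0"
        using elim abs_cos_ge_linear[of \<phi>] pi_gt_zero by (auto simp: divide_le_0_iff)
      then have "norm (g \<phi>) * norm (F_abel \<alpha> \<beta> \<mu> (X j) \<phi>) \<le> G * (K * \<bar>cos \<phi>\<bar> powr (\<delta> - 1))"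
        using True \<open>G \<ge> 0\<close> X by (intro mult_mono G K) auto
      then show ?thesis using True by (simp add: s_def norm_mult mult.assoc)
    qed (simp add: s_def)
  qed
  have int_f: "integrable lborel f"
    by (rule integrable_dominated_convergence[OF meas_f _ w AE_lim AE_bound])
       (use int_s in auto)
  then show "set_integrable lborel {0..pi} (\<lambda>\<phi>. g \<phi> * F \<alpha> \<beta> \<mu> \<phi>)"
    by (simp add: set_integrable_def f_def[abs_def])
  have "(\<lambda>j. \<integral>\<phi>. s j \<phi> \<partial>lborel) \<longlonglongrightarrow> (\<integral>\<phi>. f \<phi> \<partial>lborel)"
    by (rule integral_dominated_convergence[OF meas_f _ w AE_lim AE_bound])
       (use int_s in auto)
  moreover have "(\<integral>\<phi>. s j \<phi> \<partial>lborel) = (\<Sum>n. c n * of_real (X j ^ n / p n))" for j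
    using abel(2)[OF X, of j] by (simp add: sums_iff set_lebesgue_integral_def s_def)
  ultimately have lim1: "(\<lambda>j. \<Sum>n. c n * of_real (X j ^ n / p n)) \<longlonglongrightarrow> (LBINT \<phi>:{0..pi}. g \<phi> * F \<alpha> \<beta> \<mu> \<phi>)"
    by (simp add: set_lebesgue_integral_def f_def[abs_def])
  \<comment> \<open>Since p is smallest at 0 and X j < 1, the terms are at most
    \<open>norm (c n) / p 0\<close> for every j.\<close>
  have "summable (\<lambda>n. norm (c n * of_real (1 ^ n / p n))) \<and>
        (\<lambda>j. \<Sum>n. c n * of_real (X j ^ n / p n)) \<longlonglongrightarrow> (\<Sum>n. c n * of_real (1 ^ n / p n))"
  proof (rule tannerys_theorem[THEN conjunct2])
    show "(\<lambda>j. c n * of_real (X j ^ n / p n)) \<longlonglongrightarrow> c n * of_real (1 ^ n / p n)" for n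
      using p(1)[of n] by (intro tendsto_intros X_lim) auto
    show "\<forall>\<^sub>F (n, j) in at_top \<times>\<^sub>F sequentially.
            norm (c n * of_real (X j ^ n / p n)) \<le> norm (c n) * (1 / p 0)"
    proof (intro always_eventually allI, clarify)
      fix n j
      have "X j ^ n / p n \<le> 1 / p 0"
        using X p(1)[of 0] p(2)[of n] by (intro frac_le power_le_one) (auto intro: less_imp_le)
      then have "norm (c n) * (X j ^ n / p n) \<le> norm (c n) * (1 / p 0)"
        by (intro mult_left_mono) auto
      then show "norm (c n * of_real (X j ^ n / p n)) \<le> norm (c n) * (1 / p 0)"
        using X(1)[of j] p(1)[of n] by (simp add: norm_mult norm_divide norm_power)
    qed
    show "summable (\<lambda>n. norm (c n) * (1 / p 0))"
      by (intro summable_mult2 summable)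
  qed auto
  then have "summable (\<lambda>n. c n / of_real (p n))"
    "(\<lambda>j. \<Sum>n. c n * of_real (X j ^ n / p n)) \<longlonglongrightarrow> (\<Sum>n. c n / of_real (p n))"
    using summable_norm_cancel[of "\<lambda>n. c n / of_real (p n)"] by auto
  then have "(\<lambda>n. c n / of_real (p n)) sums (LBINT \<phi>:{0..pi}. g \<phi> * F \<alpha> \<beta> \<mu> \<phi>)"
    using LIMSEQ_unique[OF lim1] by (simp add: sums_iff)
  then show "(\<lambda>n. c n / of_real ((real (n + 1) + \<beta>) powr \<alpha>)) sums
           (LBINT \<phi>:{0..pi}. g \<phi> * F \<alpha> \<beta> \<mu> \<phi>)"
    by (simp add: p_def)
qed

subsection \<open>Bessel functions\<close>

text \<open>The coefficient of e^(in\<phi>) in (2 cos \<phi>)^k. For n < -k the binomial coefficient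
  is already zero, its lower entry being larger than k.\<close>

definition cos_power_coeff :: "nat \<Rightarrow> int \<Rightarrow> nat" where
  "cos_power_coeff k n =
     (if even (int k - n) \<and> n \<le> int k then k choose nat ((int k - n) div 2) else 0)"

text \<open>Pascal's rule, which is multiplication by 2 cos \<phi> = e^(i\<phi>) + e^(-i\<phi>) on
  the level of coefficients.\<close>

lemma cos_power_coeff_Suc:
  "cos_power_coeff (Suc k) n = cos_power_coeff k (n + 1) + cos_power_coeff k (n - 1)"
proof (cases "even (int (Suc k) - n) \<and> n \<le> int (Suc k)")
  case True
  then obtain j where j: "int (Suc k) - n = 2 * j" by (elim conjE evenE)
  with True have "j \<ge> 0" by simp
  then obtain i where i: "j = int i" by (rule nonneg_int_cases)
  have n: "n = int (Suc k) - 2 * int i" using i j by simp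
  show ?thesis
  proof (cases i)
    case 0
    then show ?thesis unfolding n by (simp add: cos_power_coeff_def)
  next
    case (Suc i')
    then show ?thesis unfolding n by (simp add: cos_power_coeff_def algebra_simps nat_add_distrib)
  qed
next
  case False
  then show ?thesis by (auto simp: cos_power_coeff_def)
qed

lemma cos_power_coeff_add: "cos_power_coeff (a + b) (int a - int b) = (a + b) choose a"
proof -
  have "int (a + b) - (int a - int b) = 2 * int b" by simp
  then show ?thesis
    by (simp add: cos_power_coeff_def binomial_symmetric[of b "a + b"])
qed

lemma set_integrable_cos_power:
  "set_integrable lborel {a..b} (\<lambda>\<phi>::real. cos \<phi> ^ k * cos (c * \<phi>))"
  by (intro borel_integrable_atLeastAtMost' continuous_intros)

text \<open>Induction on k with 2 cos \<phi> cos(n\<phi>) = cos((n+1)\<phi>) + cos((n-1)\<phi>),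
  which matches \<open>cos_power_coeff_Suc\<close>. The frequency n ranges over all integers because
  the step lowers it.\<close>

lemma integral_cos_power:
  "(LBINT \<phi>:{0..pi}. cos \<phi> ^ k * cos (of_int n * \<phi>)) = pi / 2 ^ k * cos_power_coeff k n"
proof (induction k arbitrary: n)
  case 0
  show ?case
  proof (cases "n = 0")
    case True
    then show ?thesis by (simp add: cos_power_coeff_def set_lebesgue_integral_def)
  next
    case False
    have "(\<integral>\<phi>. indicator {0..pi} \<phi> *\<^sub>R cos (of_int n * \<phi>) \<partial>lborel) =
            sin (of_int n * pi) / of_int n - sin (of_int n * 0) / of_int n"
      using False by (intro integral_FTC_atLeastAtMost)
        (auto intro!: derivative_eq_intros continuous_intros simp: has_real_derivative_iff_has_vector_derivative[symmetric])
    also have "sin (of_int n * pi) = 0" by (metis mult.commute sin_npi_int)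
    finally show ?thesis using False by (auto simp: cos_power_coeff_def set_lebesgue_integral_def)
  qed
next
  case (Suc k)
  have "cos \<phi> ^ Suc k * cos (of_int n * \<phi>) =
        (1 / 2) * (cos \<phi> ^ k * cos (of_int (n + 1) * \<phi>) + cos \<phi> ^ k * cos (of_int (n - 1) * \<phi>))" for \<phi> :: real
    by (simp add: algebra_simps cos_add cos_diff)
  then have "(LBINT \<phi>:{0..pi}. cos \<phi> ^ Suc k * cos (of_int n * \<phi>)) =
     (LBINT \<phi>:{0..pi}. (1 / 2) * (cos \<phi> ^ k * cos (of_int (n + 1) * \<phi>) + cos \<phi> ^ k * cos (of_int (n - 1) * \<phi>)))"
    by (simp only:)
  also have "\<dots> = (1 / 2) * ((LBINT \<phi>:{0..pi}. cos \<phi> ^ k * cos (of_int (n + 1) * \<phi>)) + (LBINT \<phi>:{0..pi}. cos \<phi> ^ k * cos (of_int (n - 1) * \<phi>)))"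
    by (simp only: set_integral_mult_right set_integral_add(2) set_integrable_cos_power)
  finally show ?case unfolding Suc.IH cos_power_coeff_Suc by (simp add: algebra_simps)
qed

text \<open>Under \<phi> -> pi - \<phi> the integrand gains the sign (-1)^(k+n), which is 1 here. So
  it is symmetric about pi/2, and half of the full integral remains.\<close>

lemma integral_cos_power_half:
  assumes "even (int k - n)"
  shows "(LBINT \<phi>:{0..pi/2}. cos \<phi> ^ k * cos (of_int n * \<phi>)) = pi / 2 ^ Suc k * cos_power_coeff k n"
proof -
  define h where "h \<phi> = cos \<phi> ^ k * cos (of_int n * \<phi>)" for \<phi> :: real
  have h: "h (pi - x) = h x" for x
  proof -
    have "cos (of_int n * pi) = (if even n then 1 else - 1)" "sin (of_int n * pi) = 0"
      by (metis cos_npi_int mult.commute, metis mult.commute sin_npi_int)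
    then show ?thesis using assms
      by (cases "even n") (simp_all add: h_def cos_diff right_diff_distrib)
  qed
  have int: "integrable lborel (\<lambda>x. indicator {a..b} x * h x)" for a b
    using set_integrable_cos_power[of a b k "of_int n"] by (simp add: h_def[abs_def] set_integrable_def)
  have "(\<integral>x. indicator {0..pi/2} x * h x \<partial>lborel) = (\<integral>x. indicator {0..pi/2} (pi + (- 1) * x) * h (pi + (- 1) * x) \<partial>lborel)"
    by (subst lborel_integral_real_affine[of "-1" _ pi]) auto
  also have "\<dots> = (\<integral>x. indicator {pi/2..pi} x * h x \<partial>lborel)"
    using h by (intro Bochner_Integration.integral_cong) (auto simp: indicator_def)
  finally have "2 * (\<integral>x. indicator {0..pi/2} x * h x \<partial>lborel) =
      (\<integral>x. indicator {0..pi/2} x * h x + indicator {pi/2..pi} x * h x \<partial>lborel)"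
    using int by simp
  also have "\<dots> = (\<integral>x. indicator {0..pi} x * h x \<partial>lborel)"
  proof (rule integral_cong_AE)
    show "AE x in lborel. indicator {0..pi/2} x * h x + indicator {pi/2..pi} x * h x = indicator {0..pi} x * h x"
      using AE_lborel_singleton[of "pi / 2"] by eventually_elim (auto simp: indicator_def)
  qed (use int[THEN borel_measurable_integrable] in auto)
  also have "\<dots> = pi / 2 ^ k * cos_power_coeff k n"
    using integral_cos_power[of k n] by (simp add: set_lebesgue_integral_def h_def)
  finally show ?thesis by (simp add: set_lebesgue_integral_def h_def)
qed

section \<open>Power series, bounds and continuity of the Bessel functions\<close>

lemma bessel_J_nat:
  fixes x :: "'a :: Gamma"
  shows "bessel_J (int n) x = (\<Sum>k. (-1) ^ k / (fact k * fact (k + n)) * (x / 2) ^ (2 * k + n))"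
proof -
  have "rGamma (of_int (int k + int n + 1)) = (1 / fact (k + n) :: 'a)" for k
  proof -
    have "of_int (int k + int n + 1) = (1 + of_nat (k + n) :: 'a)" by simp
    then show ?thesis by (simp only: rGamma_inverse_Gamma Gamma_fact inverse_eq_divide)
  qed
  moreover have "(x / 2) powi (2 * int k + int n) = (x / 2) ^ (2 * k + n)" for k
  proof -
    have "2 * int k + int n = int (2 * k + n)" by simp
    then show ?thesis by (simp only: power_int_of_nat)
  qed
  ultimately show ?thesis
    unfolding bessel_J_def by (simp only: times_divide_times_eq mult_1_right)
qed

definition bessel_term :: "nat \<Rightarrow> nat \<Rightarrow> real \<Rightarrow> real" where
  "bessel_term n k x = (-1) ^ k / (fact k * fact (k + n)) * (x / 2) ^ (2 * k + n)"

text \<open>Replacing (k+n)! by n! in the denominator leaves a multiple of an exponential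
  series.\<close>

lemma abs_bessel_term_le:
  "\<bar>bessel_term n k x\<bar> \<le> \<bar>x / 2\<bar> ^ n / fact n * ((x / 2) ^ 2) ^ k / fact k"
proof -
  have "\<bar>bessel_term n k x\<bar> = 1 / (fact k * fact (k + n)) * \<bar>x / 2\<bar> ^ (2 * k + n)"
    by (simp add: bessel_term_def abs_mult power_abs)
  also have "\<dots> \<le> 1 / (fact k * fact n) * \<bar>x / 2\<bar> ^ (2 * k + n)"
    by (intro mult_right_mono divide_left_mono mult_left_mono fact_mono) auto
  also have "\<bar>x / 2\<bar> ^ (2 * k + n) = ((x / 2) ^ 2) ^ k * \<bar>x / 2\<bar> ^ n"
    by (simp only: power_add power_mult power2_abs)
  also have "1 / (fact k * fact n) * \<dots> = \<bar>x / 2\<bar> ^ n / fact n * ((x / 2) ^ 2) ^ k / fact k"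
    by (simp add: mult_ac)
  finally show ?thesis .
qed

lemma sums_bessel_bound:
  fixes x :: real
  shows "(\<lambda>k. \<bar>x / 2\<bar> ^ n / fact n * ((x / 2) ^ 2) ^ k / fact k) sums (\<bar>x / 2\<bar> ^ n / fact n * exp ((x / 2) ^ 2))"
  using sums_mult[OF exp_converges[of "(x / 2) ^ 2"], of "\<bar>x / 2\<bar> ^ n / fact n"]
  by (simp add: field_simps)

lemma summable_abs_bessel_term: "summable (\<lambda>k. \<bar>bessel_term n k x\<bar>)"
  by (rule summable_comparison_test'[OF sums_summable[OF sums_bessel_bound[of x n]], of 0])
     (use abs_bessel_term_le[of n _ x] in simp)

lemma bessel_J_sums:
  fixes x :: real
  shows "(\<lambda>k. bessel_term n k x) sums bessel_J (int n) x"
  unfolding bessel_J_nat bessel_term_def[symmetric]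
  using summable_rabs_cancel[OF summable_abs_bessel_term] by (rule summable_sums)

lemma abs_bessel_J_le:
  fixes x :: real
  shows "\<bar>bessel_J (int n) x\<bar> \<le> \<bar>x / 2\<bar> ^ n / fact n * exp ((x / 2) ^ 2)"
proof -
  have "\<bar>\<Sum>k. bessel_term n k x\<bar> \<le> (\<Sum>k. \<bar>bessel_term n k x\<bar>)"
    by (rule summable_rabs[OF summable_abs_bessel_term])
  also have "\<dots> \<le> (\<Sum>k. \<bar>x / 2\<bar> ^ n / fact n * ((x / 2) ^ 2) ^ k / fact k)"
    by (intro suminf_le abs_bessel_term_le summable_abs_bessel_term sums_summable[OF sums_bessel_bound])
  finally show ?thesis using sums_bessel_bound[of x n] bessel_J_sums[of n x] by (simp add: sums_iff)
qed

text \<open>J_n(x) is (x/2)^n times an everywhere convergent power series h in (x/2)^2.\<close>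

lemma continuous_bessel_J: "continuous_on UNIV (\<lambda>x::real. bessel_J (int n) x)"
proof -
  define h where "h y = (\<Sum>k. (-1) ^ k / (fact k * fact (k + n)) * y ^ k)" for y :: real
  have summ: "summable (\<lambda>k. (-1) ^ k / (fact k * fact (k + n)) * y ^ k)" for y :: real
  proof (rule summable_comparison_test'[OF summable_exp[of "\<bar>y\<bar>"]])
    fix k :: nat
    have "fact k * 1 \<le> fact k * (fact (k + n) :: real)" by (intro mult_left_mono fact_ge_1) auto
    then have "\<bar>y\<bar> ^ k * (1 / (fact k * fact (k + n))) \<le> \<bar>y\<bar> ^ k * (1 / fact k)"
      by (intro mult_left_mono divide_left_mono) auto
    then show "norm ((-1) ^ k / (fact k * fact (k + n)) * y ^ k) \<le> inverse (fact k) * \<bar>y\<bar> ^ k"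
      by (simp add: abs_mult power_abs field_simps)
  qed
  have "bessel_J (int n) x = (x / 2) ^ n * h ((x / 2) ^ 2)" for x :: real
  proof -
    have "(x / 2) ^ (2 * k + n) = ((x / 2) ^ 2) ^ k * (x / 2) ^ n" for k
      by (simp only: power_add power_mult)
    then have "(-1) ^ k / (fact k * fact (k + n)) * (x / 2) ^ (2 * k + n) =
        (x / 2) ^ n * ((-1) ^ k / (fact k * fact (k + n)) * ((x / 2) ^ 2) ^ k)" for k
      by (simp only: mult_ac)
    then show ?thesis
      unfolding bessel_J_nat h_def by (simp only: suminf_mult[OF summ])
  qed
  moreover have "continuous_on UNIV h"
    unfolding h_def using isCont_powser_converges_everywhere[OF summ]
    by (simp add: continuous_on_eq_continuous_at)
  ultimately show ?thesis
    by (simp only:) (intro continuous_intros continuous_on_compose2[OF \<open>continuous_on UNIV h\<close>], auto)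
qed

text \<open>The first n terms vanish because \<open>rGamma\<close> is zero at nonpositive integers;
  shifting the index by n gives the series of order n with the sign (-1)^n.\<close>

lemma bessel_J_minus:
  fixes x :: real
  shows "bessel_J (- int n) x = (-1) ^ n * bessel_J (int n) x"
proof -
  define a where "a k = (-1) ^ k / fact k * rGamma (of_int (int k + - int n + 1)) * (x / 2) powi (2 * int k + - int n)" for k
  have 0: "a k = 0" if "k < n" for k
  proof -
    have "real_of_int (int k + - int n + 1) \<in> \<int>\<^sub>\<le>\<^sub>0"
      using that by (intro nonpos_Ints_of_int) auto
    then show ?thesis unfolding a_def by (simp only: rGamma_eq_zero_iff[THEN iffD2])
  qed
  have a: "a (k + n) = (-1) ^ n * bessel_term n k x" for k
  proof -
    have "int (k + n) + - int n + 1 = int k + 1" by simp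
    moreover have "rGamma (of_int (int k + 1)) = (1 / fact k :: real)"
      using Gamma_fact[of k, where 'a = real] by (simp add: rGamma_inverse_Gamma inverse_eq_divide add.commute)
    moreover have "2 * int (k + n) + - int n = int (2 * k + n)" by simp
    ultimately show ?thesis
      unfolding a_def bessel_term_def by (simp only: power_int_of_nat) (simp add: power_add mult_ac)
  qed
  have "(\<lambda>k. a (k + n)) sums ((-1) ^ n * bessel_J (int n) x)"
    unfolding a by (intro sums_mult bessel_J_sums)
  then have "a sums ((-1) ^ n * bessel_J (int n) x + (\<Sum>k<n. a k))"
    by (rule sums_iff_shift[THEN iffD1])
  then show ?thesis
    unfolding bessel_J_def a_def[symmetric] using 0 by (simp add: sums_iff)
qed

subsection \<open>Neumann's integrals\<close>

text \<open>The Cauchy product of the two series. After extending the fractions by (k+p)! (k+q)!,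
  the inner sum is Vandermonde's convolution.\<close>

lemma bessel_J_mult_sums:
  fixes x :: real
  shows "(\<lambda>k. (-1) ^ k * real ((2 * k + p + q) choose k) / (fact (k + p) * fact (k + q)) * (x / 2) ^ (2 * k + p + q))
           sums (bessel_J (int p) x * bessel_J (int q) x)"
proof -
  have "(\<Sum>i\<le>k. bessel_term p i x * bessel_term q (k - i) x) =
        (-1) ^ k * real ((2 * k + p + q) choose k) / (fact (k + p) * fact (k + q)) * (x / 2) ^ (2 * k + p + q)" for k
  proof -
    have "bessel_term p i x * bessel_term q (k - i) x =
            (-1) ^ k * (x / 2) ^ (2 * k + p + q) / (fact (k + p) * fact (k + q)) *
            real (((k + q) choose i) * ((k + p) choose (k - i)))" if "i \<le> k" for i
    proof -
      define j where "j = k - i"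
      have k: "k = i + j" using that by (simp add: j_def)
      have c1: "real ((k + q) choose i) = fact (k + q) / (fact i * fact (j + q))"
        using binomial_fact[of i "k + q", where 'a = real] by (simp add: k)
      have c2: "real ((k + p) choose j) = fact (k + p) / (fact j * fact (i + p))"
        using binomial_fact[of j "k + p", where 'a = real] by (simp add: k)
      have x: "(x / 2) ^ (2 * k + p + q) = (x / 2) ^ (2 * i + p) * (x / 2) ^ (2 * j + q)"
      proof -
        have "2 * k + p + q = (2 * i + p) + (2 * j + q)" by (simp add: k)
        then show ?thesis by (simp only: power_add)
      qed
      have s: "(-1) ^ k = (-1 :: real) ^ i * (-1) ^ j"
        by (simp add: k power_add)
      \<comment> \<open>The rearrangement behind that extension, with u = (k+p)! and v =
        (k+q)!.\<close>
      have "s1 / (a * b) * y * (s2 / (c * d) * z) = s1 * s2 * (y * z) / (u * v) * (v / (a * d) * (u / (c * b)))"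
        if "u \<noteq> 0" "v \<noteq> 0" for s1 s2 a b c d y z u v :: real
        using that by (simp add: mult_ac)
      then show ?thesis
        unfolding bessel_term_def of_nat_mult j_def [symmetric] c1 c2 x s by this simp_all
    qed
    then have "(\<Sum>i\<le>k. bessel_term p i x * bessel_term q (k - i) x) =
        (\<Sum>i\<le>k. (-1) ^ k * (x / 2) ^ (2 * k + p + q) / (fact (k + p) * fact (k + q)) *
            real (((k + q) choose i) * ((k + p) choose (k - i))))"
      by (intro sum.cong) auto
    also have "\<dots> = (-1) ^ k * (x / 2) ^ (2 * k + p + q) / (fact (k + p) * fact (k + q)) *
            real (\<Sum>i\<le>k. ((k + q) choose i) * ((k + p) choose (k - i)))"
      by (simp only: of_nat_sum sum_distrib_left)
    also have "(\<Sum>i\<le>k. ((k + q) choose i) * ((k + p) choose (k - i))) = (2 * k + p + q) choose k"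
      using vandermonde[of "k + q" "k + p" k] by (simp add: mult_2 add_ac)
    finally show ?thesis by (simp add: mult_ac)
  qed
  moreover have "(\<lambda>k. \<Sum>i\<le>k. bessel_term p i x * bessel_term q (k - i) x) sums
      ((\<Sum>k. bessel_term p k x) * (\<Sum>k. bessel_term q k x))"
    by (rule Cauchy_product_sums) (simp_all add: summable_abs_bessel_term)
  ultimately show ?thesis
    by (simp only: sums_unique[OF bessel_J_sums])
qed

text \<open>The majorant is free of \<phi>, as the M-test requires.\<close>

lemma abs_bessel_term_cos_le:
  fixes r \<phi> :: real
  shows "\<bar>bessel_term n k (2 * r * cos \<phi>)\<bar> \<le> \<bar>r\<bar> ^ n / fact n * (r ^ 2) ^ k / fact k"
proof -
  have *: "\<bar>r * cos \<phi>\<bar> \<le> \<bar>r\<bar>"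
    using mult_left_mono[of "\<bar>cos \<phi>\<bar>" 1 "\<bar>r\<bar>"] by (simp add: abs_mult)
  have "\<bar>bessel_term n k (2 * r * cos \<phi>)\<bar> \<le> \<bar>r * cos \<phi>\<bar> ^ n / fact n * (\<bar>r * cos \<phi>\<bar> ^ 2) ^ k / fact k"
    using abs_bessel_term_le[of n k "2 * r * cos \<phi>"] by simp
  also have "\<dots> \<le> \<bar>r\<bar> ^ n / fact n * (\<bar>r\<bar> ^ 2) ^ k / fact k"
    using * by (intro divide_right_mono mult_mono power_mono) auto
  finally show ?thesis by simp
qed

lemma abs_bessel_J_cos_le:
  fixes r \<phi> :: real
  shows "\<bar>bessel_J (int n) (2 * r * cos \<phi>)\<bar> \<le> \<bar>r\<bar> ^ n / fact n * exp (r ^ 2)"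
proof -
  have *: "\<bar>r * cos \<phi>\<bar> \<le> \<bar>r\<bar>"
    using mult_left_mono[of "\<bar>cos \<phi>\<bar>" 1 "\<bar>r\<bar>"] by (simp add: abs_mult)
  have "\<bar>bessel_J (int n) (2 * r * cos \<phi>)\<bar> \<le> \<bar>r * cos \<phi>\<bar> ^ n / fact n * exp (\<bar>r * cos \<phi>\<bar> ^ 2)"
    using abs_bessel_J_le[of n "2 * r * cos \<phi>"] by simp
  also have "\<dots> \<le> \<bar>r\<bar> ^ n / fact n * exp (\<bar>r\<bar> ^ 2)"
    using * by (intro mult_mono divide_right_mono power_mono) (auto simp: abs_le_square_iff)
  finally show ?thesis by simp
qed

lemma bessel_J_cos_integral_sums:
  fixes r c :: real
  shows "(\<lambda>k. (-1) ^ k / (fact k * fact (k + n)) * r ^ (2 * k + n) *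
        (LBINT \<phi>:{a..b}. cos \<phi> ^ (2 * k + n) * cos (c * \<phi>))) sums
      (LBINT \<phi>:{a..b}. bessel_J (int n) (2 * r * cos \<phi>) * cos (c * \<phi>))"
proof -
  have "(\<lambda>k. LBINT \<phi>:{a..b}. bessel_term n k (2 * r * cos \<phi>) * cos (c * \<phi>)) sums
        (LBINT \<phi>:{a..b}. bessel_J (int n) (2 * r * cos \<phi>) * cos (c * \<phi>))"
  proof (rule set_integral_sums(2))
    show "continuous_on {a..b} (\<lambda>\<phi>. bessel_term n k (2 * r * cos \<phi>) * cos (c * \<phi>))" for k
      unfolding bessel_term_def by (intro continuous_intros) auto
    show "norm (bessel_term n k (2 * r * cos \<phi>) * cos (c * \<phi>)) \<le> \<bar>r\<bar> ^ n / fact n * (r ^ 2) ^ k / fact k" for k \<phi>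
      using mult_mono[OF abs_bessel_term_cos_le[of n k r \<phi>] abs_cos_le_one[of "c * \<phi>"]] by (simp add: abs_mult)
    show "summable (\<lambda>k. \<bar>r\<bar> ^ n / fact n * (r ^ 2) ^ k / fact k)"
      using sums_summable[OF sums_bessel_bound[of "2 * r" n]] by simp
    show "(\<lambda>k. bessel_term n k (2 * r * cos \<phi>) * cos (c * \<phi>)) sums
        (bessel_J (int n) (2 * r * cos \<phi>) * cos (c * \<phi>))" for \<phi>
      by (intro sums_mult2 bessel_J_sums)
  qed
  moreover have "bessel_term n k (2 * r * cos \<phi>) * cos (c * \<phi>) =
      (-1) ^ k / (fact k * fact (k + n)) * r ^ (2 * k + n) * (cos \<phi> ^ (2 * k + n) * cos (c * \<phi>))" for k \<phi>
    by (simp add: bessel_term_def power_mult_distrib)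
  ultimately show ?thesis by (simp only: set_integral_mult_right)
qed

text \<open>Comparison of coefficients: with N = 2k + p + q, both sides carry N! over the product of
  k!, (k+p+q)!, (k+p)! and (k+q)!; only the grouping into a binomial coefficient differs.\<close>

lemma bessel_J_mult_integral_half:
  fixes r :: real
  shows "(LBINT \<theta>:{0..pi/2}. bessel_J (int (p + q)) (2 * r * cos \<theta>) * cos (of_int (int p - int q) * \<theta>)) =
           pi / 2 * (bessel_J (int p) r * bessel_J (int q) r)"
proof -
  have "(-1) ^ k / (fact k * fact (k + (p + q))) * r ^ (2 * k + (p + q)) *
          (LBINT \<phi>:{0..pi/2}. cos \<phi> ^ (2 * k + (p + q)) * cos (of_int (int p - int q) * \<phi>))
        = pi / 2 * ((-1) ^ k * real ((2 * k + p + q) choose k) / (fact (k + p) * fact (k + q)) * (r / 2) ^ (2 * k + p + q))"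
    (is "?lhs = _") for k
  proof -
    have "cos_power_coeff (2 * k + (p + q)) (int p - int q) = (2 * k + p + q) choose (k + p)"
      using cos_power_coeff_add[of "k + p" "k + q"] by (simp add: mult_2 add_ac)
    then have "?lhs = (-1) ^ k / (fact k * fact (k + (p + q))) * r ^ (2 * k + (p + q)) *
         (pi / 2 ^ Suc (2 * k + (p + q)) * real ((2 * k + p + q) choose (k + p)))"
      by (subst integral_cos_power_half) auto
    also have "real ((2 * k + p + q) choose (k + p)) = fact (2 * k + p + q) / (fact (k + p) * fact (k + q))"
      by (subst binomial_fact) (auto simp: add_ac mult_2)
    finally have lhs: "?lhs = (-1) ^ k / (fact k * fact (k + (p + q))) * r ^ (2 * k + (p + q)) *
         (pi / 2 ^ Suc (2 * k + (p + q)) * (fact (2 * k + p + q) / (fact (k + p) * fact (k + q))))" .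
    have rhs: "real ((2 * k + p + q) choose k) = fact (2 * k + p + q) / (fact k * fact (k + (p + q)))"
      by (subst binomial_fact) (auto simp: add_ac mult_2)
    show ?thesis
      unfolding lhs rhs by (simp add: power_divide add_ac mult_ac)
  qed
  then have "(\<lambda>k. pi / 2 * ((-1) ^ k * real ((2 * k + p + q) choose k) / (fact (k + p) * fact (k + q)) * (r / 2) ^ (2 * k + p + q)))
       sums (LBINT \<theta>:{0..pi/2}. bessel_J (int (p + q)) (2 * r * cos \<theta>) * cos (of_int (int p - int q) * \<theta>))"
    using bessel_J_cos_integral_sums[where n = "p + q" and r = r and a = 0 and b = "pi / 2" and c = "of_int (int p - int q)"]
    by (simp only:)
  then show ?thesis
    using sums_mult[OF bessel_J_mult_sums[of p q r], of "pi / 2"] by (rule sums_unique2)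
qed

text \<open>Neumann's integral for p = q + n. The terms with k < q vanish because the frequency 2q +
  n exceeds the power 2k + n; starting the series at k = q produces the sign (-1)^q.\<close>

lemma bessel_J_mult_integral_aux:
  fixes r :: real
  shows "(LBINT \<phi>:{0..pi}. bessel_J (int n) (2 * r * cos \<phi>) * cos (real (2 * q + n) * \<phi>)) =
           (-1) ^ q * pi * (bessel_J (int (q + n)) r * bessel_J (int q) r)"
proof -
  define I where "I k = (-1) ^ k / (fact k * fact (k + n)) * r ^ (2 * k + n) *
        (LBINT \<phi>:{0..pi}. cos \<phi> ^ (2 * k + n) * cos (real (2 * q + n) * \<phi>))" for k
  have I: "I k = (-1) ^ k / (fact k * fact (k + n)) * r ^ (2 * k + n) *
      (pi / 2 ^ (2 * k + n) * real (cos_power_coeff (2 * k + n) (int (2 * q + n))))" for k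
    using integral_cos_power[of "2 * k + n" "int (2 * q + n)"] by (simp only: I_def of_int_of_nat_eq)
  have "I (k + q) = (-1) ^ q * pi * ((-1) ^ k * real ((2 * k + (q + n) + q) choose k) /
          (fact (k + (q + n)) * fact (k + q)) * (r / 2) ^ (2 * k + (q + n) + q))" for k
  proof -
    define N where "N = 2 * k + 2 * q + n"
    have N: "2 * (k + q) + n = N" "2 * k + (q + n) + q = N" "(k + 2 * q + n) + k = N"
      by (simp_all add: N_def)
    have "int (2 * q + n) = int (k + 2 * q + n) - int k" by simp
    then have "cos_power_coeff N (int (2 * q + n)) = N choose (k + 2 * q + n)"
      using cos_power_coeff_add[of "k + 2 * q + n" k] unfolding N by metis
    also have "\<dots> = N choose k"
    proof -
      have "k \<le> N" "N - k = k + 2 * q + n" by (simp_all add: N_def)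
      then show ?thesis using binomial_symmetric[of k N] by (simp only:)
    qed
    finally have "cos_power_coeff N (int (2 * q + n)) = N choose k" .
    moreover have "k + q + n = k + (q + n)" by simp
    ultimately show ?thesis
      unfolding I N by (simp add: power_divide power_add mult_ac add_ac)
  qed
  then have "(\<lambda>k. I (k + q)) sums ((-1) ^ q * pi * (bessel_J (int (q + n)) r * bessel_J (int q) r))"
    using sums_mult[OF bessel_J_mult_sums[of "q + n" q r], of "(-1) ^ q * pi"] by (simp only:)
  moreover have "I k = 0" if "k < q" for k
    using that unfolding I by (simp add: cos_power_coeff_def)
  ultimately have "I sums ((-1) ^ q * pi * (bessel_J (int (q + n)) r * bessel_J (int q) r))"
    by (intro sums_zero_iff_shift[THEN iffD1, of q I]) auto
  moreover have "I sums (LBINT \<phi>:{0..pi}. bessel_J (int n) (2 * r * cos \<phi>) * cos (real (2 * q + n) * \<phi>))"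
    unfolding I_def by (rule bessel_J_cos_integral_sums)
  ultimately show ?thesis by (rule sums_unique2[rotated])
qed

text \<open>For p < q the order is reflected: with q = p + n the sign (-1)^n from
  \<open>bessel_J_minus\<close> and the (-1)^p of the previous lemma combine to (-1)^q.\<close>

lemma bessel_J_mult_integral:
  fixes r :: real
  shows "(LBINT \<phi>:{0..pi}. bessel_J (int p - int q) (2 * r * cos \<phi>) * cos (real (p + q) * \<phi>)) =
           (-1) ^ q * pi * (bessel_J (int p) r * bessel_J (int q) r)"
proof (cases "q \<le> p")
  case True
  then obtain n where "p = q + n" using le_Suc_ex[of q p] by auto
  then show ?thesis
    using bessel_J_mult_integral_aux[of n r q] by (simp add: algebra_simps)
next
  case False
  then obtain n where n: "q = p + n" using le_Suc_ex[of p q] by auto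
  have "(LBINT \<phi>:{0..pi}. bessel_J (int p - int q) (2 * r * cos \<phi>) * cos (real (p + q) * \<phi>)) =
        (LBINT \<phi>:{0..pi}. (-1) ^ n * (bessel_J (int n) (2 * r * cos \<phi>) * cos (real (2 * p + n) * \<phi>)))"
    by (simp add: n bessel_J_minus algebra_simps)
  also have "\<dots> = (-1) ^ n * ((-1) ^ p * pi * (bessel_J (int (p + n)) r * bessel_J (int p) r))"
    by (simp only: set_integral_mult_right bessel_J_mult_integral_aux)
  finally show ?thesis
    by (simp add: n power_add mult_ac)
qed

text \<open>Bessel's integral. In the exponential series only the powers k = 2j + n have a nonzero
  integral against cos(n\<phi>), and the j-th of these is the j-th Bessel term, with i^(2j)
  supplying its sign.\<close>

lemma bessel_J_integral_exp:
  fixes x :: real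
  shows "(LBINT \<phi>:{0..pi}. exp (\<i> * of_real (x * cos \<phi>)) * of_real (cos (real n * \<phi>))) =
           of_real pi * \<i> ^ n * of_real (bessel_J (int n) x)"
proof -
  define I where "I k = (\<i> * of_real x) ^ k / fact k * of_real (pi / 2 ^ k * cos_power_coeff k (int n))" for k
  have "(\<lambda>k. LBINT \<phi>:{0..pi}. (\<i> * of_real x) ^ k / fact k * of_real (cos \<phi> ^ k * cos (real n * \<phi>))) sums
        (LBINT \<phi>:{0..pi}. exp (\<i> * of_real (x * cos \<phi>)) * of_real (cos (real n * \<phi>)))"
  proof (rule set_integral_sums(2))
    show "continuous_on {0..pi} (\<lambda>\<phi>. (\<i> * of_real x) ^ k / fact k * of_real (cos \<phi> ^ k * cos (real n * \<phi>)))" for k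
      by (intro continuous_intros) auto
    show "norm ((\<i> * of_real x) ^ k / fact k * of_real (cos \<phi> ^ k * cos (real n * \<phi>))) \<le> inverse (fact k) * \<bar>x\<bar> ^ k" for k \<phi>
    proof -
      have "\<bar>cos \<phi>\<bar> ^ k * \<bar>cos (real n * \<phi>)\<bar> \<le> 1 * 1"
        by (intro mult_mono power_le_one) auto
      then have "\<bar>x\<bar> ^ k / fact k * (\<bar>cos \<phi>\<bar> ^ k * \<bar>cos (real n * \<phi>)\<bar>) \<le> \<bar>x\<bar> ^ k / fact k * 1"
        by (intro mult_left_mono) auto
      then show ?thesis
        by (simp add: norm_mult norm_divide norm_power power_mult_distrib) (simp add: divide_inverse mult_ac)
    qed
    show "summable (\<lambda>k. inverse (fact k) * \<bar>x\<bar> ^ k)" by (rule summable_exp)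
    show "(\<lambda>k. (\<i> * of_real x) ^ k / fact k * of_real (cos \<phi> ^ k * cos (real n * \<phi>))) sums
         (exp (\<i> * of_real (x * cos \<phi>)) * of_real (cos (real n * \<phi>)))" for \<phi>
    proof -
      have "(\<lambda>k. (\<i> * of_real (x * cos \<phi>)) ^ k /\<^sub>R fact k * of_real (cos (real n * \<phi>))) sums
         (exp (\<i> * of_real (x * cos \<phi>)) * of_real (cos (real n * \<phi>)))"
        by (intro sums_mult2 exp_converges)
      then show ?thesis
        by (simp add: power_mult_distrib scaleR_conv_of_real divide_inverse mult_ac)
    qed
  qed
  moreover have "(LBINT \<phi>:{0..pi}. (\<i> * of_real x) ^ k / fact k * of_real (cos \<phi> ^ k * cos (real n * \<phi>))) = I k" for k
    using integral_cos_power[of k "int n"]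
    by (simp add: I_def set_integral_complex_of_real del: of_real_mult)
  ultimately have I_sums: "I sums (LBINT \<phi>:{0..pi}. exp (\<i> * of_real (x * cos \<phi>)) * of_real (cos (real n * \<phi>)))"
    by (simp only:)
  have "I (2 * j + n) = of_real pi * \<i> ^ n * of_real (bessel_term n j x)" for j
  proof -
    have "cos_power_coeff (2 * j + n) (int n) = (2 * j + n) choose j"
      using cos_power_coeff_add[of "j + n" j] binomial_symmetric[of j "2 * j + n"] by (simp add: mult_2 add_ac)
    then have "real (cos_power_coeff (2 * j + n) (int n)) = fact (2 * j + n) / (fact j * fact (j + n))"
      using binomial_fact[of j "2 * j + n", where 'a = real] by (simp add: mult_2 add_ac)
    moreover have "\<i> ^ (2 * j) = (-1) ^ j"
      by (simp add: power_mult)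
    then have "(\<i> * of_real x) ^ (2 * j + n) = (-1) ^ j * \<i> ^ n * of_real (x ^ (2 * j + n))"
      by (simp add: power_mult_distrib power_add)
    ultimately show ?thesis
      by (simp add: I_def bessel_term_def power_divide mult_ac)
  qed
  then have "(\<lambda>j. I (2 * j + n)) sums (of_real pi * \<i> ^ n * of_real (bessel_J (int n) x))"
    by (simp add: sums_mult sums_of_real bessel_J_sums)
  moreover have "I k = 0" if "k \<notin> range (\<lambda>j. 2 * j + n)" for k
  proof -
    have "\<not> (even (int k - int n) \<and> int n \<le> int k)"
    proof
      assume *: "even (int k - int n) \<and> int n \<le> int k"
      moreover define i where "i = k - n"
      ultimately have "int k - int n = int i" by simp
      with * have "k = n + i" "even i" by auto
      then have "k = 2 * (i div 2) + n" by simp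
      with that show False by blast
    qed
    then show ?thesis by (auto simp: I_def cos_power_coeff_def)
  qed
  ultimately have "I sums (of_real pi * \<i> ^ n * of_real (bessel_J (int n) x))"
    using sums_mono_reindex[of "\<lambda>j. 2 * j + n" I] by (auto simp: strict_mono_def)
  then show ?thesis using I_sums by (rule sums_unique2[symmetric])
qed

subsection \<open>The integral formulas\<close>

text \<open>A subseries of the exponential series; it is applied with c = 1 to products of Bessel
  functions and with c = 2 to the orders 2l + 2 + \<mu>.\<close>

lemma summable_power_fact_shift:
  fixes y :: real and c d :: nat
  assumes "y \<ge> 0" "c > 0"
  shows "summable (\<lambda>l. y ^ (c * l + d) / fact (c * l + d))"
proof -
  have "inj (\<lambda>l. c * l + d)" using \<open>c > 0\<close> by (auto simp: inj_def)
  then have "summable ((\<lambda>n. inverse (fact n) * y ^ n) \<circ> (\<lambda>l. c * l + d))"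
    using \<open>y \<ge> 0\<close> by (intro summable_reindex summable_exp) auto
  then show ?thesis by (simp add: o_def divide_inverse mult_ac)
qed

text \<open>One factor decays factorially in l, and the other is bounded uniformly in l since y^n /
  n! \<le> e^y.\<close>

lemma summable_bessel_J_mult:
  fixes r :: real
  shows "summable (\<lambda>l. \<bar>bessel_J (int (l + p)) r * bessel_J (int (l + q)) r\<bar>)"
proof -
  define E where "E = exp ((r / 2) ^ 2)"
  have "E > 0" by (simp add: E_def)
  have exp_bound: "y ^ n / fact n \<le> exp y" if "y \<ge> 0" for y :: real and n
  proof -
    have sums: "(\<lambda>k. inverse (fact k) * y ^ k) sums exp y"
      using exp_converges[of y] by simp
    have "(\<Sum>k\<in>{n}. inverse (fact k) * y ^ k) \<le> (\<Sum>k. inverse (fact k) * y ^ k)"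
      using that by (intro sum_le_suminf sums_summable[OF sums]) auto
    also have "\<dots> = exp y"
      by (rule sums_unique[OF sums, symmetric])
    finally show ?thesis by (simp add: divide_inverse mult.commute)
  qed
  show ?thesis
  proof (rule summable_comparison_test')
    show "summable (\<lambda>l. \<bar>r / 2\<bar> ^ (1 * l + p) / fact (1 * l + p) * E * (exp \<bar>r / 2\<bar> * E))"
      by (rule summable_mult2[OF summable_mult2[OF summable_power_fact_shift]]) auto
    fix l :: nat
    have "\<bar>bessel_J (int (l + p)) r\<bar> * \<bar>bessel_J (int (l + q)) r\<bar> \<le>
        (\<bar>r / 2\<bar> ^ (l + p) / fact (l + p) * E) * (\<bar>r / 2\<bar> ^ (l + q) / fact (l + q) * E)"
      unfolding E_def by (intro mult_mono abs_bessel_J_le) auto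
    also have "\<dots> \<le> (\<bar>r / 2\<bar> ^ (l + p) / fact (l + p) * E) * (exp \<bar>r / 2\<bar> * E)"
    proof (rule mult_left_mono)
      show "\<bar>r / 2\<bar> ^ (l + q) / fact (l + q) * E \<le> exp \<bar>r / 2\<bar> * E"
        using \<open>E > 0\<close> by (intro mult_right_mono exp_bound) auto
    qed (use \<open>E > 0\<close> in simp)
    finally show "norm \<bar>bessel_J (int (l + p)) r * bessel_J (int (l + q)) r\<bar> \<le>
        \<bar>r / 2\<bar> ^ (1 * l + p) / fact (1 * l + p) * E * (exp \<bar>r / 2\<bar> * E)"
      by (simp only: real_norm_def abs_mult abs_abs mult_1)
  qed
qed

lemma continuous_on_bessel_J_cos:
  "continuous_on A (\<lambda>\<phi>. bessel_J n (2 * r * cos \<phi>) :: real)"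
proof (cases n rule: int_cases2)
  case (nonneg k)
  show ?thesis unfolding nonneg
    by (intro continuous_on_compose2[OF continuous_bessel_J] continuous_intros) auto
next
  case (nonpos k)
  show ?thesis unfolding nonpos bessel_J_minus
    by (intro continuous_intros continuous_on_compose2[OF continuous_bessel_J]) auto
qed

text \<open>\<open>F_integral\<close> for g(\<phi>) = J_\<nu>(2r cos \<phi>). Neumann's integral
  with p = l + 1 + m and q = l + 1 + m' supplies the coefficients: p - q = \<nu> does not depend on
  l, and p + q is the frequency in the series of \<open>F\<close>.\<close>

lemma single_integral_formula:
  fixes r :: real
  assumes "\<alpha> > 0" "\<beta> > -1"
  shows "set_integrable lborel {0..pi}
           (\<lambda>\<phi>. of_real (bessel_J (int m - int m') (2 * r * cos \<phi>)) * F \<alpha> \<beta> (m + m') \<phi>)"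
    and "(\<lambda>l. complex_of_real (bessel_J (int (l + 1) + int m') r * bessel_J (int (l + 1) + int m) r
             / (real (l + 1) + \<beta>) powr \<alpha>)) sums
           ((-1) ^ m' / of_real pi *
             (LBINT \<phi>:{0..pi}. of_real (bessel_J (int m - int m') (2 * r * cos \<phi>)) * F \<alpha> \<beta> (m + m') \<phi>))"
proof -
  define P where "P l = bessel_J (int (l + Suc m')) r * bessel_J (int (l + Suc m)) r" for l
  define c where "c l = complex_of_real ((-1) ^ m' * pi * P l)" for l
  define g where "g \<phi> = complex_of_real (bessel_J (int m - int m') (2 * r * cos \<phi>))" for \<phi>
  have 1: "continuous_on {0..pi} g"
    unfolding g_def by (intro continuous_intros continuous_on_bessel_J_cos)
  have 2: "(LBINT \<phi>:{0..pi}. g \<phi> * of_real ((-1) ^ Suc l * cos (real (2 * l + 2 + (m + m')) * \<phi>))) = c l" for l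
  proof -
    have e: "int m - int m' = int (l + Suc m) - int (l + Suc m')"
      "2 * l + 2 + (m + m') = (l + Suc m) + (l + Suc m')" by simp_all
    have "g \<phi> * of_real ((-1) ^ Suc l * cos (real (2 * l + 2 + (m + m')) * \<phi>)) =
          of_real ((-1) ^ Suc l * (bessel_J (int (l + Suc m) - int (l + Suc m')) (2 * r * cos \<phi>) *
            cos (real ((l + Suc m) + (l + Suc m')) * \<phi>)))" for \<phi>
      unfolding g_def e by (simp only: of_real_mult mult_ac)
    then have "(LBINT \<phi>:{0..pi}. g \<phi> * of_real ((-1) ^ Suc l * cos (real (2 * l + 2 + (m + m')) * \<phi>))) =
      of_real ((-1) ^ Suc l * ((-1) ^ (l + Suc m') * pi * (bessel_J (int (l + Suc m)) r * bessel_J (int (l + Suc m')) r)))"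
      by (simp only: set_integral_complex_of_real set_integral_mult_right bessel_J_mult_integral)
    \<comment> \<open>One factor \<open>(-1) ^ Suc l\<close> comes from the cosine series of
      \<open>F\<close>, the other from Neumann's integral; they cancel and leave (-1)^m'.\<close>
    also have "(-1) ^ Suc l * ((-1) ^ (l + Suc m') * pi * (bessel_J (int (l + Suc m)) r * bessel_J (int (l + Suc m')) r))
        = ((-1) ^ Suc l * (-1) ^ Suc l) * ((-1) ^ m' * pi * P l)"
      by (simp only: P_def power_add power_Suc mult_ac)
    also have "(-1) ^ Suc l * (-1) ^ Suc l = (1 :: real)"
      by (simp flip: power_mult_distrib)
    finally show ?thesis by (simp only: c_def mult_1)
  qed
  have 3: "summable (\<lambda>l. norm (c l))"
    using summable_mult[OF summable_bessel_J_mult[of "Suc m'" r "Suc m"], of pi]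
    unfolding c_def norm_of_real abs_mult P_def by (simp add: mult_ac)
  show "set_integrable lborel {0..pi} (\<lambda>\<phi>. of_real (bessel_J (int m - int m') (2 * r * cos \<phi>)) * F \<alpha> \<beta> (m + m') \<phi>)"
    using F_integral(1)[OF assms 1 2 3] unfolding g_def .
  have "(-1) ^ m' / of_real pi * (c l / of_real ((real (l + 1) + \<beta>) powr \<alpha>)) =
        of_real (bessel_J (int (l + 1) + int m') r * bessel_J (int (l + 1) + int m) r / (real (l + 1) + \<beta>) powr \<alpha>)" for l
  proof -
    have "int (l + 1) + int m' = int (l + Suc m')" "int (l + 1) + int m = int (l + Suc m)" by simp_all
    then have "bessel_J (int (l + 1) + int m') r * bessel_J (int (l + 1) + int m) r = P l"
      unfolding P_def by (simp only:)
    moreover have "(-1) ^ m' * (-1) ^ m' = (1 :: complex)"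
      by (simp flip: power_mult_distrib)
    ultimately show ?thesis
      by (simp add: c_def)
  qed
  then show "(\<lambda>l. complex_of_real (bessel_J (int (l + 1) + int m') r * bessel_J (int (l + 1) + int m) r
             / (real (l + 1) + \<beta>) powr \<alpha>)) sums
           ((-1) ^ m' / of_real pi *
             (LBINT \<phi>:{0..pi}. of_real (bessel_J (int m - int m') (2 * r * cos \<phi>)) * F \<alpha> \<beta> (m + m') \<phi>))"
    using sums_mult[OF F_integral(2)[OF assms 1 2 3], of "(-1) ^ m' / of_real pi"]
    unfolding g_def by (simp only:)
qed

text \<open>The inner integral is \<open>F_integral\<close> with coefficients from Bessel's integral
  of order 2l + 2 + \<mu> at 2r cos \<theta>. The outer one is again taken termwise, by Neumann's
  integral over [0, pi/2].\<close>

lemma double_integral_formula: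
  fixes r :: real and m m' :: nat
  assumes "\<alpha> > 0" "\<beta> > -1"
  defines "H \<equiv> (\<lambda>\<theta> \<phi>. exp (\<i> * of_real (2 * r * cos \<phi> * cos \<theta>)) * F \<alpha> \<beta> (m + m') \<phi> *
                        of_real (cos (of_int (int m - int m') * \<theta>)))"
  shows "set_integrable lborel {0..pi} (H \<theta>)"
    and "set_integrable lborel {0..pi / 2} (\<lambda>\<theta>. LBINT \<phi>:{0..pi}. H \<theta> \<phi>)"
    and "(\<lambda>l. complex_of_real (bessel_J (int (l + 1) + int m') r * bessel_J (int (l + 1) + int m) r
             / (real (l + 1) + \<beta>) powr \<alpha>)) sums
           (2 * \<i> powi (- int (m + m')) / of_real (pi ^ 2) *
             (LBINT \<theta>:{0..pi / 2}. LBINT \<phi>:{0..pi}. H \<theta> \<phi>))"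
proof -
  define N where "N l = 2 * l + (2 + (m + m'))" for l
  define p where "p l = (real (l + 1) + \<beta>) powr \<alpha>" for l
  have p: "p l > 0" "p 0 \<le> p l" for l
    using assms by (auto simp: p_def intro!: powr_mono2)
  define c where "c l \<theta> = of_real pi * \<i> ^ (m + m') *
      of_real (bessel_J (int (N l)) (2 * r * cos \<theta>) * cos (of_int (int m - int m') * \<theta>))" for l \<theta>
  define g where "g \<theta> \<phi> = exp (\<i> * of_real (2 * r * cos \<phi> * cos \<theta>)) *
      of_real (cos (of_int (int m - int m') * \<theta>))" for \<theta> \<phi>
  \<comment> \<open>A bound for \<open>c l \<theta>\<close> that is free of \<theta>, so the M-test
    also covers the integration over \<theta>.\<close>
  define M where "M l = pi * (\<bar>r\<bar> ^ N l / fact (N l) * exp (r ^ 2))" for l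
  have cont_g: "continuous_on {0..pi} (g \<theta>)" for \<theta>
    unfolding g_def by (intro continuous_intros)
  have c: "(LBINT \<phi>:{0..pi}. g \<theta> \<phi> * of_real ((-1) ^ Suc l * cos (real (2 * l + 2 + (m + m')) * \<phi>))) = c l \<theta>" for l \<theta>
  proof -
    have N: "2 * l + 2 + (m + m') = N l" by (simp add: N_def)
    have "g \<theta> \<phi> * of_real ((-1) ^ Suc l * cos (real (N l) * \<phi>)) =
        of_real ((-1) ^ Suc l * cos (of_int (int m - int m') * \<theta>)) *
        (exp (\<i> * of_real ((2 * r * cos \<theta>) * cos \<phi>)) * of_real (cos (real (N l) * \<phi>)))" for \<phi>
    proof -
      have "2 * r * cos \<phi> * cos \<theta> = (2 * r * cos \<theta>) * cos \<phi>" by simp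
      then show ?thesis unfolding g_def by (simp only: of_real_mult mult_ac)
    qed
    then have "(LBINT \<phi>:{0..pi}. g \<theta> \<phi> * of_real ((-1) ^ Suc l * cos (real (2 * l + 2 + (m + m')) * \<phi>))) =
        of_real ((-1) ^ Suc l * cos (of_int (int m - int m') * \<theta>)) *
        (of_real pi * \<i> ^ N l * of_real (bessel_J (int (N l)) (2 * r * cos \<theta>)))"
      unfolding N by (simp only: set_integral_mult_right bessel_J_integral_exp)
    \<comment> \<open>The even part of the exponent gives a sign that cancels the alternating sign
      in the series of \<open>F\<close>.\<close>
    also have "\<i> ^ N l = (-1) ^ Suc l * \<i> ^ (m + m')"
    proof -
      have "N l = 2 * Suc l + (m + m')" by (simp add: N_def)
      then show ?thesis by (simp only: power_add power_mult power2_i)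
    qed
    also have "of_real ((-1) ^ Suc l * cos (of_int (int m - int m') * \<theta>)) *
        (of_real pi * ((-1) ^ Suc l * \<i> ^ (m + m')) * of_real (bessel_J (int (N l)) (2 * r * cos \<theta>)))
        = ((-1) ^ Suc l * (-1) ^ Suc l) * c l \<theta>"
      unfolding c_def by (simp only: of_real_mult of_real_power of_real_minus of_real_1 mult_ac)
    also have "(-1) ^ Suc l * (-1) ^ Suc l = (1 :: complex)"
      by (simp flip: power_mult_distrib)
    finally show ?thesis by (simp only: mult_1)
  qed
  have c_bound: "norm (c l \<theta>) \<le> M l" for l \<theta>
  proof -
    have "norm (c l \<theta>) = pi * (\<bar>bessel_J (int (N l)) (2 * r * cos \<theta>)\<bar> * \<bar>cos (of_int (int m - int m') * \<theta>)\<bar>)"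
      by (simp add: c_def norm_mult norm_power abs_mult)
    also have "\<dots> \<le> pi * (\<bar>r\<bar> ^ N l / fact (N l) * exp (r ^ 2) * 1)"
      by (intro mult_left_mono mult_mono abs_bessel_J_cos_le) auto
    finally show ?thesis by (simp add: M_def)
  qed
  have summable_M: "summable M"
    unfolding M_def[abs_def] N_def by (intro summable_mult summable_mult2 summable_power_fact_shift) auto
  have summable_c: "summable (\<lambda>l. norm (c l \<theta>))" for \<theta>
    by (rule summable_comparison_test'[OF summable_M, of 0]) (use c_bound[of _ \<theta>] in simp)
  have H: "H \<theta> = (\<lambda>\<phi>. g \<theta> \<phi> * F \<alpha> \<beta> (m + m') \<phi>)" for \<theta>
    by (simp add: H_def g_def mult_ac)
  show "set_integrable lborel {0..pi} (H \<theta>)"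
    unfolding H by (rule F_integral(1)[OF assms(1,2) cont_g c summable_c])
  have sums: "(\<lambda>l. c l \<theta> / of_real (p l)) sums (LBINT \<phi>:{0..pi}. H \<theta> \<phi>)" for \<theta>
    unfolding H p_def by (rule F_integral(2)[OF assms(1,2) cont_g c summable_c])
  have cont_c: "continuous_on {0..pi / 2} (\<lambda>\<theta>. c l \<theta> / of_real (p l))" for l
    unfolding c_def using p(1)[of l] by (intro continuous_intros continuous_on_bessel_J_cos) auto
  have bound: "norm (c l \<theta> / of_real (p l)) \<le> M l / p 0" for l \<theta>
  proof -
    have "norm (c l \<theta>) / p l \<le> M l / p 0"
      using p(1)[of 0] p(2)[of l] c_bound[of l \<theta>] by (intro frac_le) (auto intro: order_trans[OF norm_ge_zero])
    then show ?thesis using p(1)[of l] by (simp add: norm_divide)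
  qed
  note swap = set_integral_sums[OF cont_c bound summable_divide[OF summable_M] sums]
  show "set_integrable lborel {0..pi / 2} (\<lambda>\<theta>. LBINT \<phi>:{0..pi}. H \<theta> \<phi>)"
    by (rule swap(1))
  have "2 * \<i> powi (- int (m + m')) / of_real (pi ^ 2) * (LBINT \<theta>:{0..pi / 2}. c l \<theta> / of_real (p l)) =
      of_real (bessel_J (int (l + 1) + int m') r * bessel_J (int (l + 1) + int m) r / (real (l + 1) + \<beta>) powr \<alpha>)" for l
  proof -
    \<comment> \<open>Sum and difference of the two orders l + 1 + m and l + 1 + m', as Neumann's
      integral needs them.\<close>
    have e: "N l = (l + Suc m) + (l + Suc m')" "int m - int m' = int (l + Suc m) - int (l + Suc m')"
      by (simp_all add: N_def)
    have "(LBINT \<theta>:{0..pi / 2}. c l \<theta> / of_real (p l)) =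
        (LBINT \<theta>:{0..pi / 2}. (of_real pi * \<i> ^ (m + m') / of_real (p l)) *
           of_real (bessel_J (int (N l)) (2 * r * cos \<theta>) * cos (of_int (int m - int m') * \<theta>)))"
      by (simp add: c_def)
    also have "\<dots> = (of_real pi * \<i> ^ (m + m') / of_real (p l)) *
        of_real (pi / 2 * (bessel_J (int (l + Suc m)) r * bessel_J (int (l + Suc m')) r))"
      unfolding e by (simp only: set_integral_mult_right set_integral_complex_of_real bessel_J_mult_integral_half)
    finally have 1: "(LBINT \<theta>:{0..pi / 2}. c l \<theta> / of_real (p l)) = (of_real pi * \<i> ^ (m + m') / of_real (p l)) *
        of_real (pi / 2 * (bessel_J (int (l + Suc m)) r * bessel_J (int (l + Suc m')) r))" .
    have 2: "int (l + 1) + int m' = int (l + Suc m')" "int (l + 1) + int m = int (l + Suc m)" by simp_all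
    have 3: "\<i> powi (- int (m + m')) = 1 / \<i> ^ (m + m')"
      by (simp only: power_int_minus power_int_of_nat inverse_eq_divide)
    have "\<i> ^ (m + m') \<noteq> 0" by simp
    then show ?thesis
      unfolding 1 2 3 p_def [symmetric] by (simp add: power2_eq_square mult_ac)
  qed
  then show "(\<lambda>l. complex_of_real (bessel_J (int (l + 1) + int m') r * bessel_J (int (l + 1) + int m) r
             / (real (l + 1) + \<beta>) powr \<alpha>)) sums
           (2 * \<i> powi (- int (m + m')) / of_real (pi ^ 2) *
             (LBINT \<theta>:{0..pi / 2}. LBINT \<phi>:{0..pi}. H \<theta> \<phi>))"
    using sums_mult[OF swap(2), of "2 * \<i> powi (- int (m + m')) / of_real (pi ^ 2)"] by (simp only:)
qed

text \<open>A Lebesgue integral defaults to 0 when the integrand is not integrable, so integrability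
  is asserted alongside each formula; \<open>sums\<close> includes convergence. The index l starts
  at 0 and stands for l + 1.\<close>

theorem theorem1p1:
  fixes \<alpha> \<beta> r :: real and m m' \<mu> :: nat and \<nu> :: int
  assumes "\<alpha> > 0" and "\<beta> > -1"
    and "\<mu> = m + m'" and "\<nu> = int m - int m'"
  shows
    "(\<forall>\<theta>\<in>{0..pi / 2}. set_integrable lborel {0..pi}
        (\<lambda>\<phi>. exp (\<i> * of_real (2 * r * cos \<phi> * cos \<theta>)) * F \<alpha> \<beta> \<mu> \<phi> * of_real (cos (of_int \<nu> * \<theta>)))) \<and>
     set_integrable lborel {0..pi / 2}
        (\<lambda>\<theta>. LBINT \<phi>:{0..pi}.
           exp (\<i> * of_real (2 * r * cos \<phi> * cos \<theta>)) * F \<alpha> \<beta> \<mu> \<phi> * of_real (cos (of_int \<nu> * \<theta>))) \<and>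
     (\<lambda>l. complex_of_real
        (bessel_J (int (l + 1) + int m') r * bessel_J (int (l + 1) + int m) r
           / (real (l + 1) + \<beta>) powr \<alpha>))
       sums
       (2 * \<i> powi (- int \<mu>) / of_real (pi ^ 2) *
          (LBINT \<theta>:{0..pi / 2}. LBINT \<phi>:{0..pi}.
             exp (\<i> * of_real (2 * r * cos \<phi> * cos \<theta>)) * F \<alpha> \<beta> \<mu> \<phi> * of_real (cos (of_int \<nu> * \<theta>)))) \<and>
     set_integrable lborel {0..pi}
        (\<lambda>\<phi>. complex_of_real (bessel_J \<nu> (2 * r * cos \<phi>)) * F \<alpha> \<beta> \<mu> \<phi>) \<and>
     (\<lambda>l. complex_of_real
        (bessel_J (int (l + 1) + int m') r * bessel_J (int (l + 1) + int m) r
           / (real (l + 1) + \<beta>) powr \<alpha>))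
       sums
       ((-1) ^ m' / of_real pi *
          (LBINT \<phi>:{0..pi}. complex_of_real (bessel_J \<nu> (2 * r * cos \<phi>)) * F \<alpha> \<beta> \<mu> \<phi>))"
  using double_integral_formula(1)[OF assms(1,2), where r = r and m = m and m' = m']
    double_integral_formula(2,3)[OF assms(1,2), where r = r and m = m and m' = m']
    single_integral_formula[OF assms(1,2), where r = r and m = m and m' = m']
  unfolding assms(3,4) by (intro conjI ballI)

end
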